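(* Let $\mathbb{H}$ be an infinite-dimensional separable Hilbert space with unit sphere $\mathbb{S}$, let $C\colon\mathbb{H}\to\mathbb{H}$ be a non-degenerate, trace-class covariance operator with complete orthonormal system of eigenvectors $(e_j)_{j\in\mathbb{N}}$ and eigenvalues $\lambda_j>0$, and let $\bar\Phi\colon\mathbb{S}\to\mathbb{R}$ be measurable and uniformly bounded. For $d\in\mathbb{N}$ let $C_d=\mathrm{diag}(\lambda_1,\dots,\lambda_d)$, $\mu_0^{(d)}=\mathrm{ACG}(C_d)$ on $\mathbb{S}^{d-1}$, and let $\mu^{(d)}$ be the probability measure on $\mathbb{S}^{d-1}$ with $$\frac{\mathrm{d}\mu^{(d)}}{\mathrm{d}\mu_0^{(d)}}(\bar x)\propto\exp(-\bar\Phi(\bar x)),\qquad \bar x\in\mathbb{S}^{d-1},$$ where $\mathbb{S}^{d-1}$ is identified with $\{\bar x_1e_1+\dots+\bar x_de_d:\ (\bar x_1,\dots,\bar x_d)\in\mathbb{S}^{d-1}\}\subset\mathbb{S}$ in order to evaluate $\bar\Phi$. Fix $s\in(0,1]$ and let $\bar K^{(d)}$ be the transition kernel on $\mathbb{S}^{d-1}$ of the reprojected pCN-MH algorithm with step size $s$ targeting $\mu^{(d)}$. Then there exists $\beta>0$ such that $$\inf_{d\in\mathbb{N}}\operatorname{gap}_{\mu^{(d)}}\bigl(\bar K^{(d)}\bigr)\ge\beta .$$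
   Context: A covariance operator is a self-adjoint positive semi-definite operator; non-degenerate means that it has no zero eigenvalue. $\mathbb{S}^{d-1}$ is the Euclidean unit sphere of $\mathbb{R}^d$. The radial projection $\Pi\colon\mathbb{R}^d\to\mathbb{S}^{d-1}$ is $\Pi(x)=x/\|x\|$ for $x\ne0$, with $\Pi(0)$ a fixed arbitrary point of $\mathbb{S}^{d-1}$. $\mathrm{ACG}(C_d)$ is the push-forward of $\mathrm{N}(0,C_d)$ under $\Pi$. Reprojected pCN-MH algorithm targeting $\mu^{(d)}$, one transition from $\bar x\in\mathbb{S}^{d-1}$ (all draws independent given the quantities their distributions depend on): draw $r\ge0$ with $r^2\sim\mathrm{Gam}(d/2,\tfrac12\bar x^\top C_d^{-1}\bar x)$ (Gamma distribution with shape $d/2$ and rate $\tfrac12\bar x^\top C_d^{-1}\bar x$) and set $x=r\bar x$; draw $w\sim\mathrm{N}(0,C_d)$ and set $y=\sqrt{1-s^2}\,x+s\,w$, $\bar y=\Pi(y)$; draw $u$ uniformly from $[0,1]$; the next state is $\bar y$ if $u\le\min\{1,\exp(\bar\Phi(\bar x)-\bar\Phi(\bar y))\}$, and $\bar x$ otherwise. For a probability measure $\mu$ and a $\mu$-reversible transition kernel $K$, let $(Kf)(x)=\int f(y)\,K(x,\mathrm{d}y)$, let $L^2_{0,\mu}=\{f\in L^2(\mu):\int f\,\mathrm{d}\mu=0\}$, and define the spectral gap $\operatorname{gap}_\mu(K)=1-\|K\|_{L^2_{0,\mu}\to L^2_{0,\mu}}$ (operator norm). *)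

theory Defs
  imports "HOL-Probability.Probability"
begin

subsection \<open>Covariance operators on a Hilbert space\<close>

definition complete_orthonormal_system :: "(nat \<Rightarrow> 'a::real_inner) \<Rightarrow> bool" where
  "complete_orthonormal_system e \<longleftrightarrow>
     (\<forall>i j. e i \<bullet> e j = (if i = j then 1 else 0)) \<and> closure (span (range e)) = UNIV"

definition covariance_operator :: "('a::real_inner \<Rightarrow> 'a) \<Rightarrow> bool" where
  "covariance_operator C \<longleftrightarrow>
     bounded_linear C \<and> (\<forall>x y. C x \<bullet> y = x \<bullet> C y) \<and> (\<forall>x. 0 \<le> x \<bullet> C x)"

definition nondegenerate :: "('a::real_vector \<Rightarrow> 'a) \<Rightarrow> bool" where
  "nondegenerate C \<longleftrightarrow> (\<forall>x. C x = 0 \<longrightarrow> x = 0)"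

text \<open>The trace-class condition for a positive semi-definite operator on an infinite-dimensional
  separable space; there the trace norm \<open>tr \<bar>C\<bar>\<close> is just the trace.\<close>

definition psd_trace_class :: "('a::real_inner \<Rightarrow> 'a) \<Rightarrow> bool" where
  "psd_trace_class C \<longleftrightarrow>
     (\<forall>b. complete_orthonormal_system b \<longrightarrow> summable (\<lambda>j. b j \<bullet> C (b j)))"


subsection \<open>Spheres in arbitrary finite dimension\<close>

text \<open>Since the dimension is quantified inside the theorem, \<open>\<real>\<^sup>d\<close> is modelled by the
  extensional functions on \<open>{..<d}\<close>. Coordinates are numbered from \<open>0\<close>; all objects are
  meant for \<open>d \<ge> 1\<close>.\<close>

definition euclidean_borel :: "nat \<Rightarrow> (nat \<Rightarrow> real) measure" where
  "euclidean_borel d = PiM {..<d} (\<lambda>_. borel)"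

definition usphere :: "nat \<Rightarrow> (nat \<Rightarrow> real) set" where
  "usphere d = {x \<in> space (euclidean_borel d). L2_set x {..<d} = 1}"

definition usphere_borel :: "nat \<Rightarrow> (nat \<Rightarrow> real) measure" where
  "usphere_borel d = restrict_space (euclidean_borel d) (usphere d)"

definition embed_coords :: "(nat \<Rightarrow> 'a::real_vector) \<Rightarrow> nat \<Rightarrow> (nat \<Rightarrow> real) \<Rightarrow> 'a" where
  "embed_coords e d x = (\<Sum>j<d. x j *\<^sub>R e j)"

text \<open>The point \<open>p\<close> is the value at the origin.\<close>

definition radial_projection ::
    "nat \<Rightarrow> (nat \<Rightarrow> real) \<Rightarrow> (nat \<Rightarrow> real) \<Rightarrow> (nat \<Rightarrow> real)" where
  "radial_projection d p x =
     (if L2_set x {..<d} = 0 then p else (\<lambda>j\<in>{..<d}. x j / L2_set x {..<d}))"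


subsection \<open>Gaussian, angular central Gaussian and target measures\<close>

text \<open>\<open>N(0, C\<^sub>d)\<close> for the diagonal matrix \<open>C\<^sub>d\<close> with entries \<open>lam 0, \<dots>, lam (d - 1)\<close>;
  \<open>inv_quadratic_form lam d x\<close> is \<open>x\<^sup>T C\<^sub>d\<^sup>-\<^sup>1 x\<close>.
  The lemma \<open>gaussian_diag_eq_density\<close> gives the usual density.\<close>

definition gaussian_diag :: "(nat \<Rightarrow> real) \<Rightarrow> nat \<Rightarrow> (nat \<Rightarrow> real) measure" where
  "gaussian_diag lam d = PiM {..<d} (\<lambda>j. density lborel (normal_density 0 (sqrt (lam j))))"

definition inv_quadratic_form :: "(nat \<Rightarrow> real) \<Rightarrow> nat \<Rightarrow> (nat \<Rightarrow> real) \<Rightarrow> real" where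
  "inv_quadratic_form lam d x = (\<Sum>j<d. (x j)\<^sup>2 / lam j)"

lemma gaussian_diag_eq_density:
  assumes lam: "\<And>j. lam j > 0"
  shows "gaussian_diag lam d = density (PiM {..<d} (\<lambda>_. lborel))
    (\<lambda>x. ennreal (exp (- inv_quadratic_form lam d x / 2) / sqrt ((2 * pi) ^ d * (\<Prod>j<d. lam j))))"
proof -
  interpret N: prob_space "density lborel (normal_density 0 (sqrt (lam j)))" for j
    using lam by (intro prob_space_normal_density) simp
  interpret N: product_sigma_finite "\<lambda>j. density lborel (normal_density 0 (sqrt (lam j)))"
    by standard
  interpret L: product_sigma_finite "\<lambda>_::nat. lborel :: real measure" by standard
  have dens: "exp (- inv_quadratic_form lam d x / 2) / sqrt ((2 * pi) ^ d * (\<Prod>j<d. lam j))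
      = (\<Prod>j<d. normal_density 0 (sqrt (lam j)) (x j))" for x
  proof -
    have "exp (- inv_quadratic_form lam d x / 2) = (\<Prod>j<d. exp (- ((x j)\<^sup>2 / (2 * lam j))))"
      by (simp add: inv_quadratic_form_def exp_sum[symmetric] sum_negf sum_divide_distrib
          divide_divide_eq_left mult.commute)
    moreover have "sqrt ((2 * pi) ^ d * (\<Prod>j<d. lam j)) = (\<Prod>j<d. sqrt (2 * pi * lam j))"
      by (induction d) (simp_all add: real_sqrt_mult mult_ac)
    ultimately show ?thesis
      using lam by (simp add: normal_density_def prod_dividef less_imp_le)
  qed
  have "density (PiM {..<d} (\<lambda>_. lborel)) (\<lambda>x. ennreal (\<Prod>j<d. normal_density 0 (sqrt (lam j)) (x j)))
      = PiM {..<d} (\<lambda>j. density lborel (normal_density 0 (sqrt (lam j))))" (is "?D = _")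
  proof (rule N.PiM_eqI)
    show "sets ?D = sets (PiM {..<d} (\<lambda>j. density lborel (normal_density 0 (sqrt (lam j)))))"
      by (simp cong: sets_PiM_cong)
    fix A assume A: "\<And>j. j \<in> {..<d} \<Longrightarrow> A j \<in> sets (density lborel (normal_density 0 (sqrt (lam j))))"
    then have A': "\<And>j. j < d \<Longrightarrow> A j \<in> sets borel" by simp
    have Pi: "Pi\<^sub>E {..<d} A \<in> sets (PiM {..<d} (\<lambda>_. lborel))"
      using A' by (intro sets_PiM_I_finite) auto
    have "emeasure ?D (Pi\<^sub>E {..<d} A) = (\<integral>\<^sup>+x. (\<Prod>j<d. ennreal (normal_density 0 (sqrt (lam j)) (x j))
        * indicator (A j) (x j)) \<partial>PiM {..<d} (\<lambda>_. lborel))"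
      using Pi
      by (subst emeasure_density)
         (auto intro!: nn_integral_cong simp: prod.distrib prod_ennreal space_PiM PiE_iff
            indicator_def split: if_splits)
    also have "\<dots> = (\<Prod>j<d. \<integral>\<^sup>+t. ennreal (normal_density 0 (sqrt (lam j)) t)
        * indicator (A j) t \<partial>lborel)"
      using A' by (intro L.product_nn_integral_prod) auto
    also have "\<dots> = (\<Prod>j\<in>{..<d}. emeasure (density lborel (normal_density 0 (sqrt (lam j)))) (A j))"
      using A' by (intro prod.cong) (auto simp: emeasure_density)
    finally show "emeasure ?D (Pi\<^sub>E {..<d} A) =
      (\<Prod>j\<in>{..<d}. emeasure (density lborel (normal_density 0 (sqrt (lam j)))) (A j))" .
  qed simp
  then show ?thesis unfolding gaussian_diag_def dens by (rule sym)
qed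

definition ACG :: "(nat \<Rightarrow> real) \<Rightarrow> nat \<Rightarrow> (nat \<Rightarrow> real) \<Rightarrow> (nat \<Rightarrow> real) measure" where
  "ACG lam d p = distr (gaussian_diag lam d) (usphere_borel d) (radial_projection d p)"

definition gibbs_measure :: "'b measure \<Rightarrow> ('b \<Rightarrow> real) \<Rightarrow> 'b measure" where
  "gibbs_measure M \<Psi> =
     density M (\<lambda>x. ennreal (exp (- \<Psi> x) / (\<integral>z. exp (- \<Psi> z) \<partial>M)))"


subsection \<open>The reprojected pCN-MH kernel\<close>

definition gamma_distribution :: "real \<Rightarrow> real \<Rightarrow> real measure" where
  "gamma_distribution shape rate = density lborel (\<lambda>t. ennreal (if t < 0 then 0
     else rate powr shape / Gamma shape * t powr (shape - 1) * exp (- rate * t)))"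

definition pcn_proposal ::
    "nat \<Rightarrow> (nat \<Rightarrow> real) \<Rightarrow> real \<Rightarrow> real \<Rightarrow> (nat \<Rightarrow> real) \<Rightarrow> (nat \<Rightarrow> real) \<Rightarrow> (nat \<Rightarrow> real)" where
  "pcn_proposal d p s r w x =
     radial_projection d p (\<lambda>j\<in>{..<d}. sqrt (1 - s\<^sup>2) * (r * x j) + s * w j)"

text \<open>The next state from \<open>x\<close> is a function of the independent draws \<open>r\<^sup>2\<close>, \<open>w\<close>, \<open>u\<close>
  (here \<open>t\<close> is \<open>r\<^sup>2\<close>), and the kernel is its distribution.\<close>

definition reprojected_pCN_MH ::
    "(nat \<Rightarrow> real) \<Rightarrow> nat \<Rightarrow> (nat \<Rightarrow> real) \<Rightarrow> ((nat \<Rightarrow> real) \<Rightarrow> real) \<Rightarrow> real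
      \<Rightarrow> (nat \<Rightarrow> real) \<Rightarrow> (nat \<Rightarrow> real) measure" where
  "reprojected_pCN_MH lam d p \<Psi> s x =
     distr
       (gamma_distribution (real d / 2) (inv_quadratic_form lam d x / 2)
         \<Otimes>\<^sub>M (gaussian_diag lam d \<Otimes>\<^sub>M uniform_measure lborel {0..1}))
       (usphere_borel d)
       (\<lambda>(t, w, u).
          let y = pcn_proposal d p s (sqrt t) w x
          in if u \<le> min 1 (exp (\<Psi> x - \<Psi> y)) then y else x)"


subsection \<open>Spectral gap\<close>

definition L2 :: "'b measure \<Rightarrow> ('b \<Rightarrow> real) set" where
  "L2 M = {f \<in> borel_measurable M. integrable M (\<lambda>x. (f x)\<^sup>2)}"

definition L2_0 :: "'b measure \<Rightarrow> ('b \<Rightarrow> real) set" where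
  "L2_0 M = {f \<in> L2 M. (\<integral>x. f x \<partial>M) = 0}"

definition L2_norm :: "'b measure \<Rightarrow> ('b \<Rightarrow> real) \<Rightarrow> real" where
  "L2_norm M f = sqrt (\<integral>x. (f x)\<^sup>2 \<partial>M)"

definition kernel_op :: "('b \<Rightarrow> 'b measure) \<Rightarrow> ('b \<Rightarrow> real) \<Rightarrow> 'b \<Rightarrow> real" where
  "kernel_op K f x = (\<integral>y. f y \<partial>K x)"

text \<open>The operator norm is the least bound. It is \<open>\<infinity>\<close> if the kernel does not induce
  a bounded operator from \<open>L2_0 M\<close> to itself; this does not occur for reversible kernels.\<close>

definition L2_0_opnorm :: "'b measure \<Rightarrow> ('b \<Rightarrow> 'b measure) \<Rightarrow> ereal" where
  "L2_0_opnorm M K = Inf {ereal c | c. 0 \<le> c \<and>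
     (\<forall>f\<in>L2_0 M. kernel_op K f \<in> L2_0 M \<and> L2_norm M (kernel_op K f) \<le> c * L2_norm M f)}"

definition spectral_gap :: "'b measure \<Rightarrow> ('b \<Rightarrow> 'b measure) \<Rightarrow> ereal" where
  "spectral_gap M K = 1 - L2_0_opnorm M K"

end

theory Submission
  imports Defs
begin

text \<open>Resampling the radius turns a direction distributed as \<open>ACG(C\<^sub>d)\<close> into a vector distributed as
  \<open>N(0, C\<^sub>d)\<close>, so a stationary proposal step of the reprojected chain is the radial projection of a
  stationary pair \<open>(X, a X + s W)\<close> of the pCN proposal, where \<open>a = sqrt (1 - s\<^sup>2)\<close>. Every combination
  of independent copies of \<open>X\<close> with unit coefficient vector is again distributed as \<open>X\<close>, and pairs of
  such combinations with scalar product \<open>a\<close> are distributed as \<open>(X, a X + s W)\<close>. Two couplings give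
  estimates free of the dimension. Two independent copies are joined through a third vector with
  equal small correlations to both, and correlation \<open>a\<close> is lowered to that level by repeated squaring;
  the triangle inequality then bounds the variance by a multiple of \<open>E [(f X - f (a X + s W))\<^sup>2]\<close>.
  Three vectors with pairwise correlation \<open>a\<close> form an odd cycle, which bounds \<open>E [(f X)\<^sup>2]\<close> by
  \<open>9/4 * E [(f X + f (a X + s W))\<^sup>2]\<close>. Since the potential is bounded, acceptance and the change of
  measure cost only constant factors, and polarisation converts the two quadratic form bounds for the
  reversible kernel into a bound on its norm.\<close>

subsection \<open>Gaussian measures and rotations\<close>

text \<open>The difficulty is uniformity in the dimension. The gap of the Gaussian step is dimension
  free and could be read off its Hermite eigenfunctions; the couplings replace that expansion. They
  use only linear combinations that act with the same scalars on every coordinate, so neither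
  \<open>d\<close> nor the eigenvalues \<open>lam\<close> can enter a constant. A norm bound must
  control both ends of the spectrum: differences of f keep it away from 1, sums keep it away from
  -1. Each use of the triangle inequality yields two equal terms with factor 2, hence a factor 4 per
  squaring of the correlation and one more for the third vector. This is the origin of
  \<open>4 ^ Suc m\<close>, where m depends on s alone. The coupling estimates are integrals in
  [0, \<infinity>] of arbitrary measurable f. Integrability enters only where mean-zero functions
  and norms are treated.\<close>

lemma nn_integral_affine_PiM_lborel:
  fixes t :: "'i \<Rightarrow> real"
  assumes "finite I" "c \<noteq> 0"
    and "f \<in> borel_measurable (PiM I (\<lambda>_. lborel))"
  shows "(\<integral>\<^sup>+x. f x \<partial>PiM I (\<lambda>_. lborel)) =
    ennreal (\<bar>c\<bar> ^ card I) * (\<integral>\<^sup>+x. f (\<lambda>j\<in>I. t j + c * x j) \<partial>PiM I (\<lambda>_. lborel))"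
  using assms(1,3)
proof (induction I arbitrary: f rule: finite_induct)
  case empty
  interpret L: product_sigma_finite "\<lambda>_::'i. lborel :: real measure" by standard
  show ?case by (simp add: L.nn_integral_empty restrict_def emeasure_PiM_empty[unfolded space_PiM_empty] space_PiM_empty)
next
  case (insert i I)
  interpret L: product_sigma_finite "\<lambda>_::'i. lborel :: real measure" by standard
  note [measurable] = insert.prems
  have upd: "(\<lambda>j\<in>I. t j + c * x j)(i := t i + c * y) = (\<lambda>j\<in>insert i I. t j + c * (x(i := y)) j)"
    for x y using insert.hyps by (auto simp: fun_eq_iff)
  have [measurable]: "(\<lambda>x. \<lambda>j\<in>J. t j + c * x j) \<in> PiM J (\<lambda>_. lborel) \<rightarrow>\<^sub>M PiM J (\<lambda>_. lborel)" for J
    by measurable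
  have fi: "(\<lambda>x. f (x(i := y))) \<in> borel_measurable (PiM I (\<lambda>_. lborel))" for y
    using insert.hyps by measurable
  interpret I: finite_product_sigma_finite "\<lambda>_::'i. lborel :: real measure" I
    by standard (rule insert.hyps)
  have meas: "(\<lambda>y. \<integral>\<^sup>+x. f ((g x)(i := h y)) \<partial>PiM I (\<lambda>_. lborel)) \<in> borel_measurable borel"
    if [measurable]: "g \<in> PiM I (\<lambda>_. lborel) \<rightarrow>\<^sub>M PiM I (\<lambda>_. lborel)" "h \<in> borel \<rightarrow>\<^sub>M borel" for g :: "('i \<Rightarrow> real) \<Rightarrow> 'i \<Rightarrow> real" and h :: "real \<Rightarrow> real"
  proof -
    have "(\<lambda>p. (g (snd p))(i := h (fst p))) \<in> borel \<Otimes>\<^sub>M PiM I (\<lambda>_. lborel) \<rightarrow>\<^sub>M PiM (insert i I) (\<lambda>_. lborel)"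
      by (rule measurable_fun_upd[where J=I]) auto
    from measurable_compose[OF this insert.prems] show ?thesis
      using I.borel_measurable_nn_integral[of "\<lambda>y x. f ((g x)(i := h y))" borel]
      by (simp add: case_prod_unfold)
  qed
  have "(\<integral>\<^sup>+x. f x \<partial>PiM (insert i I) (\<lambda>_. lborel)) =
      (\<integral>\<^sup>+y. (\<integral>\<^sup>+x. f (x(i := y)) \<partial>PiM I (\<lambda>_. lborel)) \<partial>lborel)"
    using insert by (intro L.product_nn_integral_insert_rev) auto
  also have "\<dots> = ennreal \<bar>c\<bar> * (\<integral>\<^sup>+y. (\<integral>\<^sup>+x. f (x(i := t i + c * y)) \<partial>PiM I (\<lambda>_. lborel)) \<partial>lborel)"
    using \<open>c \<noteq> 0\<close> meas[of "\<lambda>x. x" "\<lambda>y. y"] by (intro nn_integral_real_affine) simp_all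
  also have "(\<integral>\<^sup>+y. (\<integral>\<^sup>+x. f (x(i := t i + c * y)) \<partial>PiM I (\<lambda>_. lborel)) \<partial>lborel) =
     (\<integral>\<^sup>+y. ennreal (\<bar>c\<bar> ^ card I) * (\<integral>\<^sup>+x. f ((\<lambda>j\<in>I. t j + c * x j)(i := t i + c * y)) \<partial>PiM I (\<lambda>_. lborel)) \<partial>lborel)"
    by (subst insert.IH[OF fi]) (rule refl)
  also have "\<dots> = ennreal (\<bar>c\<bar> ^ card I) *
     (\<integral>\<^sup>+y. (\<integral>\<^sup>+x. f (\<lambda>j\<in>insert i I. t j + c * (x(i := y)) j) \<partial>PiM I (\<lambda>_. lborel)) \<partial>lborel)"
    unfolding upd[symmetric] measurable_lborel1
    by (intro nn_integral_cmult) (simp add: meas)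
  also have "(\<integral>\<^sup>+y. (\<integral>\<^sup>+x. f (\<lambda>j\<in>insert i I. t j + c * (x(i := y)) j) \<partial>PiM I (\<lambda>_. lborel)) \<partial>lborel) =
     (\<integral>\<^sup>+x. f (\<lambda>j\<in>insert i I. t j + c * x j) \<partial>PiM (insert i I) (\<lambda>_. lborel))"
    using insert by (intro L.product_nn_integral_insert_rev[symmetric]) auto
  finally have "(\<integral>\<^sup>+x. f x \<partial>PiM (insert i I) (\<lambda>_. lborel)) = ennreal \<bar>c\<bar> * (ennreal (\<bar>c\<bar> ^ card I) *
    (\<integral>\<^sup>+x. f (\<lambda>j\<in>insert i I. t j + c * x j) \<partial>PiM (insert i I) (\<lambda>_. lborel)))" .
  moreover have "\<bar>c\<bar> ^ card (insert i I) = \<bar>c\<bar> * \<bar>c\<bar> ^ card I"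
    using insert.hyps by simp
  ultimately show ?case
    by (simp only: ennreal_mult[OF abs_ge_zero zero_le_power[OF abs_ge_zero]] mult.assoc)
qed

text \<open>The multiple c x is written \<open>lincomb d c x 0 x\<close>, and adding noise u is
  \<open>lincomb d a x 1 u\<close>, so one measurability rule and one coordinatewise comparison
  cover all linear operations. The restriction keeps the result extensional, that is, a point of
  \<open>euclidean_borel d\<close>.\<close>

definition lincomb :: "nat \<Rightarrow> real \<Rightarrow> (nat \<Rightarrow> real) \<Rightarrow> real \<Rightarrow> (nat \<Rightarrow> real) \<Rightarrow> nat \<Rightarrow> real" where
  "lincomb d a x b y = (\<lambda>j\<in>{..<d}. a * x j + b * y j)"

lemma lincomb_apply [simp]: "j < d \<Longrightarrow> lincomb d a x b y j = a * x j + b * y j"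
  by (simp add: lincomb_def)

lemma space_euclidean_borel: "x \<in> space (euclidean_borel d) \<longleftrightarrow> x \<in> extensional {..<d}"
  by (simp add: euclidean_borel_def space_PiM PiE_def)

lemma euclidean_borel_eqI:
  "\<lbrakk>x \<in> space (euclidean_borel d); y \<in> space (euclidean_borel d); \<And>j. j < d \<Longrightarrow> x j = y j\<rbrakk> \<Longrightarrow> x = y"
  unfolding space_euclidean_borel by (rule extensionalityI[of _ "{..<d}"]) auto

lemma lincomb_space [simp]: "lincomb d a x b y \<in> space (euclidean_borel d)"
  by (simp add: space_euclidean_borel lincomb_def)

lemma measurable_coord:
  "f \<in> N \<rightarrow>\<^sub>M euclidean_borel d \<Longrightarrow> j < d \<Longrightarrow> (\<lambda>p. f p j) \<in> borel_measurable N"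
  unfolding euclidean_borel_def
  by (rule measurable_compose[OF _ measurable_component_singleton]) auto

lemma measurable_euclidean_borelI:
  "(\<And>j. j < d \<Longrightarrow> (\<lambda>p. f p j) \<in> borel_measurable N) \<Longrightarrow> (\<lambda>p. \<lambda>j\<in>{..<d}. f p j) \<in> N \<rightarrow>\<^sub>M euclidean_borel d"
  unfolding euclidean_borel_def by (rule measurable_restrict) simp

lemma measurable_lincomb [measurable (raw)]:
  assumes [measurable]: "f \<in> N \<rightarrow>\<^sub>M euclidean_borel d" "g \<in> N \<rightarrow>\<^sub>M euclidean_borel d"
    "a \<in> borel_measurable N" "b \<in> borel_measurable N"
  shows "(\<lambda>p. lincomb d (a p) (f p) (b p) (g p)) \<in> N \<rightarrow>\<^sub>M euclidean_borel d"
  unfolding lincomb_def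
  by (intro measurable_euclidean_borelI borel_measurable_add borel_measurable_times
      measurable_coord[OF assms(1)] measurable_coord[OF assms(2)] assms(3,4))

lemma measurable_inv_quadratic_form [measurable (raw)]:
  assumes [measurable]: "f \<in> N \<rightarrow>\<^sub>M euclidean_borel d"
  shows "(\<lambda>p. inv_quadratic_form lam d (f p)) \<in> borel_measurable N"
  unfolding inv_quadratic_form_def 
  by (intro borel_measurable_sum borel_measurable_divide borel_measurable_power measurable_coord[OF assms]) auto

lemma measurable_L2_set [measurable (raw)]:
  assumes [measurable]: "f \<in> N \<rightarrow>\<^sub>M euclidean_borel d"
  shows "(\<lambda>p. L2_set (f p) {..<d}) \<in> borel_measurable N"
  unfolding L2_set_def
  by (intro borel_measurable_sqrt[THEN measurable_compose[rotated]] borel_measurable_sum borel_measurable_power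
      measurable_coord[OF assms]) auto

lemma sets_PiM_lborel_euclidean [measurable_cong]:
  "sets (PiM {..<d} (\<lambda>_. lborel)) = sets (euclidean_borel d)"
  unfolding euclidean_borel_def by (rule sets_PiM_cong) simp_all

lemma sets_gaussian_diag [simp, measurable_cong]: "sets (gaussian_diag lam d) = sets (euclidean_borel d)"
  unfolding gaussian_diag_def euclidean_borel_def by (rule sets_PiM_cong) simp_all

lemma space_gaussian_diag [simp]: "space (gaussian_diag lam d) = space (euclidean_borel d)"
  by (rule sets_eq_imp_space_eq) simp

lemma space_PiM_lborel_euclidean: "space (PiM {..<d} (\<lambda>_. lborel)) = space (euclidean_borel d)"
  by (rule sets_eq_imp_space_eq) (rule sets_PiM_lborel_euclidean)

text \<open>One common scaling factor is enough: a rotation of a pair of vectors is carried out as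
  two such substitutions, each in one vector while the other is held fixed.\<close>

lemma nn_integral_shift_scale:
  assumes [measurable]: "F \<in> borel_measurable (euclidean_borel d)" and "c > 0"
  shows "(\<integral>\<^sup>+x. F x \<partial>PiM {..<d} (\<lambda>_. lborel)) =
    ennreal (c ^ d) * (\<integral>\<^sup>+x. F (lincomb d b t c x) \<partial>PiM {..<d} (\<lambda>_. lborel))"
  using nn_integral_affine_PiM_lborel[of "{..<d}" c F "\<lambda>j. b * t j"] assms
  by (simp add: lincomb_def cong: measurable_cong_sets)

section \<open>Gaussian integrals as Lebesgue integrals, and their invariance under reflections of
  pairs\<close>

definition gauss_density :: "(nat \<Rightarrow> real) \<Rightarrow> nat \<Rightarrow> (nat \<Rightarrow> real) \<Rightarrow> real" where
  "gauss_density lam d x = exp (- inv_quadratic_form lam d x / 2) / sqrt ((2 * pi) ^ d * (\<Prod>j<d. lam j))"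

lemma measurable_gauss_density [measurable (raw)]:
  assumes [measurable]: "f \<in> N \<rightarrow>\<^sub>M euclidean_borel d"
  shows "(\<lambda>p. gauss_density lam d (f p)) \<in> borel_measurable N"
  unfolding gauss_density_def by measurable

locale diag_gaussian =
  fixes lam :: "nat \<Rightarrow> real" and d :: nat
  assumes lam_pos: "\<And>j. lam j > 0"
begin

abbreviation "\<gamma> \<equiv> gaussian_diag lam d"
abbreviation "\<Lambda> \<equiv> PiM {..<d} (\<lambda>_. lborel :: real measure)"
abbreviation "E \<equiv> euclidean_borel d"

sublocale prob_space \<gamma>
proof -
  have "prob_space (density lborel (normal_density 0 (sqrt (lam j))))" for j
    using lam_pos by (intro prob_space_normal_density) simp
  then show "prob_space \<gamma>"
    unfolding gaussian_diag_def by (intro prob_space_PiM)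
qed

sublocale lborel_finite: finite_product_sigma_finite "\<lambda>_::nat. lborel :: real measure" "{..<d}"
  by standard simp

lemma gauss_density_nonneg: "0 \<le> gauss_density lam d x"
  unfolding gauss_density_def
  by (intro divide_nonneg_nonneg real_sqrt_ge_zero mult_nonneg_nonneg prod_nonneg)
     (auto intro: less_imp_le lam_pos)

lemma nn_integral_gaussian:
  "F \<in> borel_measurable E \<Longrightarrow>
    (\<integral>\<^sup>+x. F x \<partial>\<gamma>) = (\<integral>\<^sup>+x. ennreal (gauss_density lam d x) * F x \<partial>\<Lambda>)"
  unfolding gaussian_diag_eq_density[OF lam_pos] gauss_density_def[symmetric]
  by (subst nn_integral_density) (auto cong: measurable_cong_sets simp: sets_PiM_lborel_euclidean)

text \<open>The matrix with rows (a, s) and (s, -a) is orthogonal, so the sum of the two quadratic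
  forms is preserved coordinate by coordinate.\<close>

lemma gauss_density_reflect:
  assumes "a\<^sup>2 + s\<^sup>2 = 1"
  shows "gauss_density lam d (lincomb d a y s v) * gauss_density lam d (lincomb d s y (-a) v) =
    gauss_density lam d y * gauss_density lam d v"
proof -
  have *: "((a * p + s * q)\<^sup>2 + (s * p - a * q)\<^sup>2) = p\<^sup>2 + q\<^sup>2" for p q :: real
  proof -
    have "((a * p + s * q)\<^sup>2 + (s * p - a * q)\<^sup>2) = (a\<^sup>2 + s\<^sup>2) * (p\<^sup>2 + q\<^sup>2)"
      by (simp add: power2_eq_square algebra_simps)
    then show ?thesis using assms by simp
  qed
  have "inv_quadratic_form lam d (lincomb d a y s v) + inv_quadratic_form lam d (lincomb d s y (-a) v)
    = inv_quadratic_form lam d y + inv_quadratic_form lam d v"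
    unfolding inv_quadratic_form_def sum.distrib[symmetric]
    by (intro sum.cong) (auto simp: add_divide_distrib[symmetric] *)
  then have "- inv_quadratic_form lam d (lincomb d a y s v)/2 + - inv_quadratic_form lam d (lincomb d s y (-a) v)/2
    = - inv_quadratic_form lam d y/2 + - inv_quadratic_form lam d v/2"
    by (simp add: field_simps)
  then show ?thesis
    unfolding gauss_density_def by (simp add: exp_add[symmetric])
qed

lemma nn_integral_Fubini_lborel:
  assumes [measurable]: "case_prod F \<in> borel_measurable (E \<Otimes>\<^sub>M E)"
  shows "(\<integral>\<^sup>+x. \<integral>\<^sup>+y. F x y \<partial>\<Lambda> \<partial>\<Lambda>) = (\<integral>\<^sup>+y. \<integral>\<^sup>+x. F x y \<partial>\<Lambda> \<partial>\<Lambda>)"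
proof -
  interpret pair_sigma_finite \<Lambda> \<Lambda> by standard
  show ?thesis by (rule Fubini') measurable
qed

lemma nn_integral_gaussian_pair:
  assumes [measurable]: "case_prod F \<in> borel_measurable (E \<Otimes>\<^sub>M E)"
  shows "(\<integral>\<^sup>+x. \<integral>\<^sup>+y. F x y \<partial>\<gamma> \<partial>\<gamma>) =
    (\<integral>\<^sup>+x. \<integral>\<^sup>+y. ennreal (gauss_density lam d x * gauss_density lam d y) * F x y \<partial>\<Lambda> \<partial>\<Lambda>)"
proof -
  have "(\<integral>\<^sup>+x. \<integral>\<^sup>+y. F x y \<partial>\<gamma> \<partial>\<gamma>) =
    (\<integral>\<^sup>+x. ennreal (gauss_density lam d x) * (\<integral>\<^sup>+y. F x y \<partial>\<gamma>) \<partial>\<Lambda>)"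
    by (rule nn_integral_gaussian) measurable
  also have "\<dots> = (\<integral>\<^sup>+x. \<integral>\<^sup>+y. ennreal (gauss_density lam d x * gauss_density lam d y) * F x y \<partial>\<Lambda> \<partial>\<Lambda>)"
  proof (rule nn_integral_cong)
    fix x assume "x \<in> space \<Lambda>"
    then have [measurable]: "x \<in> space E" "F x \<in> borel_measurable E"
      by (auto simp: space_PiM_lborel_euclidean)
    show "ennreal (gauss_density lam d x) * (\<integral>\<^sup>+y. F x y \<partial>\<gamma>) =
      (\<integral>\<^sup>+y. ennreal (gauss_density lam d x * gauss_density lam d y) * F x y \<partial>\<Lambda>)"
      by (subst nn_integral_gaussian, measurable, subst nn_integral_cmult[symmetric], measurable)
         (simp add: ennreal_mult gauss_density_nonneg mult.assoc)
  qed
  finally show ?thesis .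
qed

text \<open>The reflection is its own inverse, and it splits into two substitutions. With x fixed, y
  = a x + s w replaces w and costs the factor \<open>n ^ d\<close>; after exchanging the integrals,
  with y fixed, v replaces x through x = a y + s v and costs \<open>s ^ d\<close>. The factors
  cancel, and the product of the densities is invariant.\<close>

lemma gaussian_reflection:
  assumes as: "a\<^sup>2 + s\<^sup>2 = 1" "s > 0" and [measurable]: "case_prod F \<in> borel_measurable (E \<Otimes>\<^sub>M E)"
  shows "(\<integral>\<^sup>+x. \<integral>\<^sup>+w. F (lincomb d a x s w) (lincomb d s x (-a) w) \<partial>\<gamma> \<partial>\<gamma>) = (\<integral>\<^sup>+x. \<integral>\<^sup>+w. F x w \<partial>\<gamma> \<partial>\<gamma>)"
proof -
  let ?g = "gauss_density lam d"
  \<comment> \<open>Solving y = a x + s w for w gives w = m x + n y; this is where s > 0 is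
    needed.\<close>
  define m n where "m = -a/s" and "n = 1/s"
  have n: "n > 0" "s * n = 1" using as by (auto simp: n_def)
  have 1: "lincomb d a x s (lincomb d m x n y) = y" if "y \<in> space E" for x y
    using that as by (intro euclidean_borel_eqI[of _ d]) (auto simp: field_simps m_def n_def)
  have 2: "lincomb d s (lincomb d a y s v) (-a) (lincomb d s y (-a) v) = v" if "v \<in> space E" for y v
  proof (rule euclidean_borel_eqI[of _ d])
    fix j assume "j < d"
    moreover have "s * (a * y j + s * v j) - a * (s * y j - a * v j) = (a\<^sup>2 + s\<^sup>2) * v j"
      by (simp add: algebra_simps power2_eq_square)
    ultimately show "lincomb d s (lincomb d a y s v) (-a) (lincomb d s y (-a) v) j = v j"
      using as by simp
  qed (use that in auto)
  \<comment> \<open>After the second substitution, the old w = m x + n y is the second entry of the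
    reflection of (y, v).\<close>
  have 3: "lincomb d m (lincomb d a y s v) n y = lincomb d s y (-a) v" for y v
  proof (rule euclidean_borel_eqI[of _ d])
    fix j assume j: "j < d"
    have "m * (a * y j + s * v j) + n * y j = n * ((1 - a\<^sup>2) * y j - a * s * v j)"
      using as by (simp add: field_simps power2_eq_square m_def n_def)
    also have "\<dots> = (s * n) * (s * y j - a * v j)"
    proof -
      have *: "1 - a\<^sup>2 = s * s" using as by (simp add: power2_eq_square)
      show ?thesis unfolding * by (simp add: algebra_simps)
    qed
    finally show "lincomb d m (lincomb d a y s v) n y j = lincomb d s y (-a) v j"
      using n j by simp
  qed auto
  have "(\<integral>\<^sup>+x. \<integral>\<^sup>+w. F (lincomb d a x s w) (lincomb d s x (-a) w) \<partial>\<gamma> \<partial>\<gamma>) =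
    (\<integral>\<^sup>+x. \<integral>\<^sup>+w. ennreal (?g x * ?g w) * F (lincomb d a x s w) (lincomb d s x (-a) w) \<partial>\<Lambda> \<partial>\<Lambda>)"
    by (rule nn_integral_gaussian_pair) measurable
  also have "\<dots> = (\<integral>\<^sup>+x. ennreal (n^d) * (\<integral>\<^sup>+y. ennreal (?g x * ?g (lincomb d m x n y)) *
      F y (lincomb d s x (-a) (lincomb d m x n y)) \<partial>\<Lambda>) \<partial>\<Lambda>)"
  proof (rule nn_integral_cong)
    fix x assume "x \<in> space \<Lambda>"
    then have [measurable]: "x \<in> space E" by (auto simp: space_PiM_lborel_euclidean)
    show "(\<integral>\<^sup>+w. ennreal (?g x * ?g w) * F (lincomb d a x s w) (lincomb d s x (-a) w) \<partial>\<Lambda>) =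
      ennreal (n^d) * (\<integral>\<^sup>+y. ennreal (?g x * ?g (lincomb d m x n y)) *
      F y (lincomb d s x (-a) (lincomb d m x n y)) \<partial>\<Lambda>)"
      using as n
      by (subst nn_integral_shift_scale[where b=m and t=x and c=n])
         (measurable, auto intro!: arg_cong2[where f="(*)"] nn_integral_cong simp: 1 space_PiM_lborel_euclidean)
  qed
  also have "\<dots> = ennreal (n^d) * (\<integral>\<^sup>+x. \<integral>\<^sup>+y. ennreal (?g x * ?g (lincomb d m x n y)) *
      F y (lincomb d s x (-a) (lincomb d m x n y)) \<partial>\<Lambda> \<partial>\<Lambda>)"
    by (rule nn_integral_cmult) measurable
  also have "(\<integral>\<^sup>+x. \<integral>\<^sup>+y. ennreal (?g x * ?g (lincomb d m x n y)) *
      F y (lincomb d s x (-a) (lincomb d m x n y)) \<partial>\<Lambda> \<partial>\<Lambda>) =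
     (\<integral>\<^sup>+y. \<integral>\<^sup>+x. ennreal (?g x * ?g (lincomb d m x n y)) *
      F y (lincomb d s x (-a) (lincomb d m x n y)) \<partial>\<Lambda> \<partial>\<Lambda>)"
    by (rule nn_integral_Fubini_lborel) measurable
  also have "\<dots> = (\<integral>\<^sup>+y. ennreal (s^d) * (\<integral>\<^sup>+v. ennreal (?g y * ?g v) * F y v \<partial>\<Lambda>) \<partial>\<Lambda>)"
  proof (rule nn_integral_cong)
    fix y assume "y \<in> space \<Lambda>"
    then have [measurable]: "y \<in> space E" by (auto simp: space_PiM_lborel_euclidean)
    show "(\<integral>\<^sup>+x. ennreal (?g x * ?g (lincomb d m x n y)) *
      F y (lincomb d s x (-a) (lincomb d m x n y)) \<partial>\<Lambda>) =
      ennreal (s^d) * (\<integral>\<^sup>+v. ennreal (?g y * ?g v) * F y v \<partial>\<Lambda>)"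
      using as n
      by (subst nn_integral_shift_scale[where b=a and t=y and c=s])
         (measurable, auto intro!: arg_cong2[where f="(*)"] nn_integral_cong
            simp: 2 3 space_PiM_lborel_euclidean gauss_density_reflect[OF as(1)])
  qed
  also have "\<dots> = ennreal (s^d) * (\<integral>\<^sup>+y. \<integral>\<^sup>+v. ennreal (?g y * ?g v) * F y v \<partial>\<Lambda> \<partial>\<Lambda>)"
    by (rule nn_integral_cmult) measurable
  also have "(\<integral>\<^sup>+y. \<integral>\<^sup>+v. ennreal (?g y * ?g v) * F y v \<partial>\<Lambda> \<partial>\<Lambda>) = (\<integral>\<^sup>+y. \<integral>\<^sup>+v. F y v \<partial>\<gamma> \<partial>\<gamma>)"
    by (rule nn_integral_gaussian_pair[symmetric]) measurable
  finally have "(\<integral>\<^sup>+x. \<integral>\<^sup>+w. F (lincomb d a x s w) (lincomb d s x (-a) w) \<partial>\<gamma> \<partial>\<gamma>) =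
    ennreal (n ^ d) * (ennreal (s ^ d) * (\<integral>\<^sup>+y. \<integral>\<^sup>+v. F y v \<partial>\<gamma> \<partial>\<gamma>))" .
  moreover have "ennreal (n ^ d) * ennreal (s ^ d) = 1"
  proof -
    have "n ^ d * s ^ d = 1" using n by (simp add: power_mult_distrib[symmetric] mult.commute)
    then show ?thesis using n as by (simp add: ennreal_mult[symmetric])
  qed
  ultimately show ?thesis by (simp add: mult.assoc[symmetric])
qed

end

subsection \<open>Dirichlet forms of the pCN proposal\<close>

text \<open>Expanding the square would give a better constant for square integrable h. The pointwise
  inequality holds in [0, \<infinity>] and so needs no integrability.\<close>

lemma (in prob_space) four_sq_le_nine_sq_sum:
  fixes h :: "'a \<Rightarrow> real"
  assumes [measurable]: "h \<in> borel_measurable M"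
  shows "4 * (\<integral>\<^sup>+x. ennreal ((h x)\<^sup>2) \<partial>M) \<le> 9 * (\<integral>\<^sup>+x. \<integral>\<^sup>+y. ennreal ((h x + h y)\<^sup>2) \<partial>M \<partial>M)"
proof -
  let ?e = "\<lambda>x y. ennreal ((h x + h y)\<^sup>2)"
  \<comment> \<open>\<open>2 h x = (h x + h y) - (h y + h z) + (h x + h z)\<close> with \<open>x\<close>, \<open>y\<close>, \<open>z\<close> independent\<close>
  have "4 * ennreal ((h x)\<^sup>2) \<le> 3 * (?e x y + ?e y z + ?e x z)" for x y z
  proof -
    \<comment> \<open>Cauchy-Schwarz against the vector (1, -1, 1), with the defect written as a sum
      of squares.\<close>
    have eq: "3 * (p\<^sup>2 + q\<^sup>2 + r\<^sup>2) - (p - q + r)\<^sup>2 = (p + q)\<^sup>2 + (p - r)\<^sup>2 + (q + r)\<^sup>2" for p q r :: real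
      by (simp add: power2_eq_square algebra_simps)
    have "(p - q + r)\<^sup>2 \<le> 3 * (p\<^sup>2 + q\<^sup>2 + r\<^sup>2)" for p q r :: real
      using eq[of p q r] zero_le_power2[of "p + q"] zero_le_power2[of "p - r"] zero_le_power2[of "q + r"]
      by linarith
    from this[of "h x + h y" "h y + h z" "h x + h z"]
    have "4 * (h x)\<^sup>2 \<le> 3 * ((h x + h y)\<^sup>2 + (h y + h z)\<^sup>2 + (h x + h z)\<^sup>2)"
      by (simp add: power_mult_distrib)
    then have "ennreal (4 * (h x)\<^sup>2) \<le> ennreal (3 * ((h x + h y)\<^sup>2 + (h y + h z)\<^sup>2 + (h x + h z)\<^sup>2))"
      by (rule ennreal_leI)
    then show ?thesis
      by (simp add: ennreal_mult)
  qed
  then have "(\<integral>\<^sup>+x. \<integral>\<^sup>+y. \<integral>\<^sup>+z. 4 * ennreal ((h x)\<^sup>2) \<partial>M \<partial>M \<partial>M) \<le>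
    (\<integral>\<^sup>+x. \<integral>\<^sup>+y. \<integral>\<^sup>+z. 3 * (?e x y + ?e y z + ?e x z) \<partial>M \<partial>M \<partial>M)"
    by (intro nn_integral_mono)
  also have "\<dots> = 3 * ((\<integral>\<^sup>+x. \<integral>\<^sup>+y. ?e x y \<partial>M \<partial>M) + (\<integral>\<^sup>+x. \<integral>\<^sup>+y. ?e x y \<partial>M \<partial>M) + (\<integral>\<^sup>+x. \<integral>\<^sup>+y. ?e x y \<partial>M \<partial>M))"
    by (simp add: nn_integral_cmult nn_integral_add emeasure_space_1)
  also have "\<dots> = 9 * (\<integral>\<^sup>+x. \<integral>\<^sup>+y. ?e x y \<partial>M \<partial>M)"
  proof -
    have "3 * (t + t + t) = 9 * t" for t :: ennreal
    proof -
      have "t + t + t = (1 + 1 + 1) * t" by (simp only: distrib_right mult_1_left)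
      then show ?thesis by (simp add: mult.assoc[symmetric])
    qed
    then show ?thesis by simp
  qed
  finally show ?thesis
    by (simp add: nn_integral_cmult emeasure_space_1)
qed

lemma sq_diff_triangle:
  fixes p q r :: real
  shows "ennreal ((p - r)\<^sup>2) \<le> 2 * ennreal ((p - q)\<^sup>2) + 2 * ennreal ((q - r)\<^sup>2)"
proof -
  have "2 * (p - q)\<^sup>2 + 2 * (q - r)\<^sup>2 - (p - r)\<^sup>2 = (p - 2 * q + r)\<^sup>2"
    by (simp add: power2_eq_square algebra_simps)
  then have "(p - r)\<^sup>2 \<le> 2 * (p - q)\<^sup>2 + 2 * (q - r)\<^sup>2"
    using zero_le_power2[of "p - 2 * q + r"] by linarith
  then have "ennreal ((p - r)\<^sup>2) \<le> ennreal (2 * (p - q)\<^sup>2 + 2 * (q - r)\<^sup>2)"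
    by (rule ennreal_leI)
  then show ?thesis by (simp add: ennreal_mult)
qed

section \<open>Stationary pCN pairs and their Dirichlet forms\<close>

context diag_gaussian
begin

lemma emeasure_gaussian_space [simp]: "emeasure \<gamma> (space E) = 1"
  using emeasure_space_1 by simp

lemma nn_integral_Fubini_gaussian:
  assumes [measurable]: "case_prod F \<in> borel_measurable (E \<Otimes>\<^sub>M E)"
  shows "(\<integral>\<^sup>+x. \<integral>\<^sup>+y. F x y \<partial>\<gamma> \<partial>\<gamma>) = (\<integral>\<^sup>+y. \<integral>\<^sup>+x. F x y \<partial>\<gamma> \<partial>\<gamma>)"
proof -
  interpret pair_sigma_finite \<gamma> \<gamma> by standard
  show ?thesis by (rule Fubini') measurable
qed

lemma nn_integral_gaussian_add2:
  assumes [measurable]: "case_prod A \<in> borel_measurable (E \<Otimes>\<^sub>M E)" "case_prod B \<in> borel_measurable (E \<Otimes>\<^sub>M E)"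
  shows "(\<integral>\<^sup>+x. \<integral>\<^sup>+y. 2 * A x y + 2 * B x y \<partial>\<gamma> \<partial>\<gamma>) =
    2 * (\<integral>\<^sup>+x. \<integral>\<^sup>+y. A x y \<partial>\<gamma> \<partial>\<gamma>) + 2 * (\<integral>\<^sup>+x. \<integral>\<^sup>+y. B x y \<partial>\<gamma> \<partial>\<gamma>)"
proof -
  have "(\<integral>\<^sup>+x. \<integral>\<^sup>+y. 2 * A x y + 2 * B x y \<partial>\<gamma> \<partial>\<gamma>) =
    (\<integral>\<^sup>+x. 2 * (\<integral>\<^sup>+y. A x y \<partial>\<gamma>) + 2 * (\<integral>\<^sup>+y. B x y \<partial>\<gamma>) \<partial>\<gamma>)"
    by (rule nn_integral_cong) (simp add: nn_integral_add nn_integral_cmult)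
  also have "\<dots> = 2 * (\<integral>\<^sup>+x. \<integral>\<^sup>+y. A x y \<partial>\<gamma> \<partial>\<gamma>) + 2 * (\<integral>\<^sup>+x. \<integral>\<^sup>+y. B x y \<partial>\<gamma> \<partial>\<gamma>)"
    by (simp add: nn_integral_add nn_integral_cmult)
  finally show ?thesis .
qed

text \<open>After division by \<kappa>, the combination is the first entry of a reflected pair,
  hence a single Gaussian vector.\<close>

lemma gaussian_sum:
  assumes "\<alpha>\<^sup>2 + \<beta>\<^sup>2 = \<kappa>\<^sup>2" "\<kappa> \<ge> 0" "\<beta> > 0" and [measurable]: "H \<in> borel_measurable E"
  shows "(\<integral>\<^sup>+v. \<integral>\<^sup>+w. H (lincomb d \<alpha> v \<beta> w) \<partial>\<gamma> \<partial>\<gamma>) = (\<integral>\<^sup>+w. H (lincomb d \<kappa> w 0 w) \<partial>\<gamma>)"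
proof -
  have \<kappa>: "\<kappa> > 0"
  proof (rule ccontr)
    assume "\<not> \<kappa> > 0"
    then have "\<kappa> = 0" using assms(2) by simp
    then show False using assms(1,3) by (simp add: sum_power2_eq_zero_iff)
  qed
  define a s where "a = \<alpha>/\<kappa>" and "s = \<beta>/\<kappa>"
  have as: "\<kappa> * a = \<alpha>" "\<kappa> * s = \<beta>" "s > 0"
    using \<kappa> assms(3) by (auto simp: a_def s_def)
  have one: "a\<^sup>2 + s\<^sup>2 = 1"
    using \<kappa> assms(1) by (simp add: a_def s_def power_divide add_divide_distrib[symmetric])
  have eq: "lincomb d \<kappa> (lincomb d a v s w) 0 (lincomb d a v s w) = lincomb d \<alpha> v \<beta> w" for v w
    unfolding as(1,2)[symmetric] by (intro euclidean_borel_eqI[of _ d]) (auto simp: algebra_simps)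
  have "(\<integral>\<^sup>+v. \<integral>\<^sup>+w. H (lincomb d \<kappa> (lincomb d a v s w) 0 (lincomb d a v s w)) \<partial>\<gamma> \<partial>\<gamma>) =
    (\<integral>\<^sup>+v. \<integral>\<^sup>+w. H (lincomb d \<kappa> v 0 v) \<partial>\<gamma> \<partial>\<gamma>)"
    by (rule gaussian_reflection[OF one as(3)]) measurable
  then show ?thesis
    unfolding eq by simp
qed

text \<open>The expectation of F over the stationary pair. The parameter is the correlation a and
  not the step size \<open>sqrt (1 - a\<^sup>2)\<close>, because correlations multiply along
  successive steps.\<close>

definition pcn :: "real \<Rightarrow> ((nat \<Rightarrow> real) \<Rightarrow> (nat \<Rightarrow> real) \<Rightarrow> ennreal) \<Rightarrow> ennreal" where
  "pcn a F = (\<integral>\<^sup>+x. \<integral>\<^sup>+w. F x (lincomb d a x (sqrt (1 - a\<^sup>2)) w) \<partial>\<gamma> \<partial>\<gamma>)"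

text \<open>With x fixed, two independent noise terms merge into one, and only the total variance
  matters. This is how each later coupling is recognised as a pCN pair.\<close>

lemma gaussian_sum_shift:
  assumes \<kappa>: "\<alpha>\<^sup>2 + \<beta>\<^sup>2 = 1 - a\<^sup>2" "\<beta> > 0" and [measurable]: "H \<in> borel_measurable E" "x \<in> space E"
  shows "(\<integral>\<^sup>+v. \<integral>\<^sup>+w. H (lincomb d a x 1 (lincomb d \<alpha> v \<beta> w)) \<partial>\<gamma> \<partial>\<gamma>) =
    (\<integral>\<^sup>+w. H (lincomb d a x (sqrt (1 - a\<^sup>2)) w) \<partial>\<gamma>)"
proof -
  have "1 - a\<^sup>2 \<ge> 0" using \<kappa>(1) sum_power2_ge_zero[of \<alpha> \<beta>] by linarith
  moreover have "lincomb d a x 1 (lincomb d r w 0 w) = lincomb d a x r w" for w r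
    by (rule euclidean_borel_eqI[of _ d]) auto
  ultimately show ?thesis
    using gaussian_sum[of \<alpha> \<beta> "sqrt (1 - a\<^sup>2)" "\<lambda>u. H (lincomb d a x 1 u)"] \<kappa> by simp
qed

text \<open>A nonnegative correlation a can be explained by a common factor: both entries share b z
  with b^2 = a and carry independent noise of variance 1 - a. Given z they are independent and
  identically distributed, which yields both the symmetry of the pair and the bound on sums.\<close>

lemma pcn_conditionally_iid:
  assumes a: "0 \<le> a" "a < 1" and [measurable]: "case_prod F \<in> borel_measurable (E \<Otimes>\<^sub>M E)"
  shows "pcn a F = (\<integral>\<^sup>+z. \<integral>\<^sup>+v. \<integral>\<^sup>+w. F (lincomb d (sqrt a) z (sqrt (1 - a)) v)
    (lincomb d (sqrt a) z (sqrt (1 - a)) w) \<partial>\<gamma> \<partial>\<gamma> \<partial>\<gamma>)"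
proof -
  define b c where "b = sqrt a" and "c = sqrt (1 - a)"
  have bc: "b\<^sup>2 = a" "c\<^sup>2 = 1 - a" "c > 0" "b * b = a" "c * c = 1 - a"
    using a by (auto simp: b_def c_def)
  \<comment> \<open>Reflecting (z, v) gives a new pair whose first entry is y = b z + c v. If v now
    denotes the second entry, then z = b y + c v, and G is the integrand in these variables.\<close>
  define G where "G = (\<lambda>y v. \<integral>\<^sup>+w. F y (lincomb d b (lincomb d b y c v) c w) \<partial>\<gamma>)"
  have [measurable]: "case_prod G \<in> borel_measurable (E \<Otimes>\<^sub>M E)"
    unfolding G_def by measurable
  have undo: "lincomb d b (lincomb d b (lincomb d b z c v) c (lincomb d c z (- b) v)) c w = lincomb d b z c w" for z v w
  proof (rule euclidean_borel_eqI[of _ d])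
    fix j assume j: "j < d"
    have "b * (b * z j + c * v j) + c * (c * z j - b * v j) = (b * b + c * c) * z j"
      by (simp add: algebra_simps)
    then show "lincomb d b (lincomb d b (lincomb d b z c v) c (lincomb d c z (- b) v)) c w j = lincomb d b z c w j"
      using j bc by simp
  qed auto
  have coef: "lincomb d b (lincomb d b y c v) c w = lincomb d a y 1 (lincomb d (b * c) v c w)" for y v w
    by (intro euclidean_borel_eqI[of _ d]) (auto simp: algebra_simps simp flip: bc(4))
  have "(\<integral>\<^sup>+z. \<integral>\<^sup>+v. \<integral>\<^sup>+w. F (lincomb d b z c v) (lincomb d b z c w) \<partial>\<gamma> \<partial>\<gamma> \<partial>\<gamma>) =
    (\<integral>\<^sup>+z. \<integral>\<^sup>+v. G (lincomb d b z c v) (lincomb d c z (-b) v) \<partial>\<gamma> \<partial>\<gamma>)"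
    by (simp add: G_def undo)
  also have "\<dots> = (\<integral>\<^sup>+y. \<integral>\<^sup>+v. G y v \<partial>\<gamma> \<partial>\<gamma>)"
    using bc by (intro gaussian_reflection) auto
  also have "\<dots> = pcn a F"
    unfolding pcn_def G_def coef
  proof (rule nn_integral_cong)
    fix y assume "y \<in> space \<gamma>"
    then have xE [measurable]: "y \<in> space E" by simp
    have "(b * c)\<^sup>2 + c\<^sup>2 = 1 - a\<^sup>2"
      unfolding power_mult_distrib bc by (simp add: power2_eq_square algebra_simps)
    then show "(\<integral>\<^sup>+v. \<integral>\<^sup>+w. F y (lincomb d a y 1 (lincomb d (b * c) v c w)) \<partial>\<gamma> \<partial>\<gamma>) =
      (\<integral>\<^sup>+w. F y (lincomb d a y (sqrt (1 - a\<^sup>2)) w) \<partial>\<gamma>)"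
      using bc by (intro gaussian_sum_shift xE) auto
  qed
  finally show ?thesis by (simp add: b_def c_def)
qed

text \<open>Given the common factor z, the entries are exchangeable by Fubini. This is the
  reversibility of the proposal.\<close>

lemma pcn_swap:
  assumes a: "0 \<le> a" "a < 1" and [measurable]: "case_prod F \<in> borel_measurable (E \<Otimes>\<^sub>M E)"
  shows "pcn a (\<lambda>x y. F y x) = pcn a F"
proof -
  have "(\<integral>\<^sup>+v. \<integral>\<^sup>+w. F (lincomb d (sqrt a) z (sqrt (1 - a)) w) (lincomb d (sqrt a) z (sqrt (1 - a)) v) \<partial>\<gamma> \<partial>\<gamma>) =
    (\<integral>\<^sup>+v. \<integral>\<^sup>+w. F (lincomb d (sqrt a) z (sqrt (1 - a)) v) (lincomb d (sqrt a) z (sqrt (1 - a)) w) \<partial>\<gamma> \<partial>\<gamma>)"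
    if [measurable]: "z \<in> space E" for z
    by (rule nn_integral_Fubini_gaussian) measurable
  moreover have "case_prod (\<lambda>x y. F y x) \<in> borel_measurable (E \<Otimes>\<^sub>M E)"
    by measurable
  ultimately show ?thesis
    using pcn_conditionally_iid[OF a, of "\<lambda>x y. F y x"] pcn_conditionally_iid[OF a assms(3)]
    by (auto intro: nn_integral_cong)
qed

lemma pcn_fst: "pcn a (\<lambda>x y. f x) = (\<integral>\<^sup>+x. f x \<partial>\<gamma>)"
  by (simp add: pcn_def emeasure_space_1)

lemma pcn_snd:
  assumes "0 \<le> a" "a < 1" and [measurable]: "f \<in> borel_measurable E"
  shows "pcn a (\<lambda>x y. f y) = (\<integral>\<^sup>+x. f x \<partial>\<gamma>)"
  using pcn_swap[OF assms(1,2), of "\<lambda>x y. f x"] by (simp add: pcn_fst)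

text \<open>Conditioning on z reduces the claim to independent copies, with
  \<open>four_sq_le_nine_sq_sum\<close> applied to the function of the remaining noise. The sign of
  a is essential: for correlations near -1 an odd function makes f x + f y small.\<close>

lemma pcn_sq_sum_lower:
  assumes a: "0 \<le> a" "a < 1" and [measurable]: "f \<in> borel_measurable E"
  shows "4 * (\<integral>\<^sup>+x. ennreal ((f x)\<^sup>2) \<partial>\<gamma>) \<le> 9 * pcn a (\<lambda>x y. ennreal ((f x + f y)\<^sup>2))"
proof -
  let ?L = "\<lambda>z v. lincomb d (sqrt a) z (sqrt (1 - a)) v"
  have "4 * (\<integral>\<^sup>+x. ennreal ((f x)\<^sup>2) \<partial>\<gamma>) = 4 * pcn a (\<lambda>x y. ennreal ((f x)\<^sup>2))"
    by (simp add: pcn_fst)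
  also have "\<dots> = (\<integral>\<^sup>+z. 4 * (\<integral>\<^sup>+v. ennreal ((f (?L z v))\<^sup>2) \<partial>\<gamma>) \<partial>\<gamma>)"
    using a by (subst pcn_conditionally_iid) (auto simp: nn_integral_cmult emeasure_space_1)
  also have "\<dots> \<le> (\<integral>\<^sup>+z. 9 * (\<integral>\<^sup>+v. \<integral>\<^sup>+w. ennreal ((f (?L z v) + f (?L z w))\<^sup>2) \<partial>\<gamma> \<partial>\<gamma>) \<partial>\<gamma>)"
    by (intro nn_integral_mono four_sq_le_nine_sq_sum) auto
  also have "\<dots> = 9 * pcn a (\<lambda>x y. ennreal ((f x + f y)\<^sup>2))"
    using a by (subst pcn_conditionally_iid) (auto simp: nn_integral_cmult)
  finally show ?thesis .
qed

abbreviation "dirichlet a f \<equiv> pcn a (\<lambda>x y. ennreal ((f x - f y)\<^sup>2))"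

text \<open>Two consecutive steps of correlation a form one step of correlation a^2, so the triangle
  inequality through the intermediate point compares the two forms.\<close>

lemma dirichlet_square_le:
  assumes a: "0 \<le> a" "a < 1" and [measurable]: "f \<in> borel_measurable E"
  shows "dirichlet (a\<^sup>2) f \<le> 4 * dirichlet a f"
proof -
  define s where "s = sqrt (1 - a\<^sup>2)"
  have "a\<^sup>2 < 1" using a by (simp add: abs_square_less_1)
  then have s: "s > 0" "s\<^sup>2 = 1 - a\<^sup>2" by (auto simp: s_def)
  let ?Y = "\<lambda>x v. lincomb d a x s v"
  have coef: "?Y (?Y x v) w = lincomb d (a\<^sup>2) x 1 (lincomb d (a * s) v s w)" for x v w
    by (intro euclidean_borel_eqI[of _ d]) (auto simp: power2_eq_square algebra_simps)
  have "dirichlet (a\<^sup>2) f = (\<integral>\<^sup>+x. \<integral>\<^sup>+v. \<integral>\<^sup>+w. ennreal ((f x - f (?Y (?Y x v) w))\<^sup>2) \<partial>\<gamma> \<partial>\<gamma> \<partial>\<gamma>)"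
    unfolding pcn_def coef
  proof (rule nn_integral_cong)
    fix x assume "x \<in> space \<gamma>"
    then have xE [measurable]: "x \<in> space E" by simp
    have "(a * s)\<^sup>2 + s\<^sup>2 = 1 - (a\<^sup>2)\<^sup>2"
      unfolding power_mult_distrib s by (simp add: power2_eq_square algebra_simps)
    then show "(\<integral>\<^sup>+w. ennreal ((f x - f (lincomb d (a\<^sup>2) x (sqrt (1 - (a\<^sup>2)\<^sup>2)) w))\<^sup>2) \<partial>\<gamma>) =
      (\<integral>\<^sup>+v. \<integral>\<^sup>+w. ennreal ((f x - f (lincomb d (a\<^sup>2) x 1 (lincomb d (a * s) v s w)))\<^sup>2) \<partial>\<gamma> \<partial>\<gamma>)"
      using s by (intro gaussian_sum_shift[symmetric] xE) auto
  qed
  also have "\<dots> \<le> (\<integral>\<^sup>+x. \<integral>\<^sup>+v. \<integral>\<^sup>+w. 2 * ennreal ((f x - f (?Y x v))\<^sup>2) +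
      2 * ennreal ((f (?Y x v) - f (?Y (?Y x v) w))\<^sup>2) \<partial>\<gamma> \<partial>\<gamma> \<partial>\<gamma>)"
    by (intro nn_integral_mono sq_diff_triangle)
  also have "\<dots> = (\<integral>\<^sup>+x. \<integral>\<^sup>+v. 2 * ennreal ((f x - f (?Y x v))\<^sup>2) +
      2 * (\<integral>\<^sup>+w. ennreal ((f (?Y x v) - f (?Y (?Y x v) w))\<^sup>2) \<partial>\<gamma>) \<partial>\<gamma> \<partial>\<gamma>)"
  proof (intro nn_integral_cong)
    fix x v assume "x \<in> space \<gamma>" "v \<in> space \<gamma>"
    then have [measurable]: "x \<in> space E" "v \<in> space E" by simp_all
    show "(\<integral>\<^sup>+w. 2 * ennreal ((f x - f (?Y x v))\<^sup>2) +
      2 * ennreal ((f (?Y x v) - f (?Y (?Y x v) w))\<^sup>2) \<partial>\<gamma>) = 2 * ennreal ((f x - f (?Y x v))\<^sup>2) +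
      2 * (\<integral>\<^sup>+w. ennreal ((f (?Y x v) - f (?Y (?Y x v) w))\<^sup>2) \<partial>\<gamma>)"
      by (subst nn_integral_add, measurable) (simp add: nn_integral_cmult emeasure_space_1)
  qed
  also have "\<dots> = 2 * (\<integral>\<^sup>+x. \<integral>\<^sup>+v. ennreal ((f x - f (?Y x v))\<^sup>2) \<partial>\<gamma> \<partial>\<gamma>) +
      2 * (\<integral>\<^sup>+x. \<integral>\<^sup>+v. (\<integral>\<^sup>+w. ennreal ((f (?Y x v) - f (?Y (?Y x v) w))\<^sup>2) \<partial>\<gamma>) \<partial>\<gamma> \<partial>\<gamma>)"
    by (rule nn_integral_gaussian_add2) measurable
  also have "(\<integral>\<^sup>+x. \<integral>\<^sup>+v. ennreal ((f x - f (?Y x v))\<^sup>2) \<partial>\<gamma> \<partial>\<gamma>) = dirichlet a f"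
    by (simp add: pcn_def s_def)
  \<comment> \<open>By \<open>pcn_snd\<close> the intermediate point has law \<gamma> again, so the
    second step also starts in stationarity.\<close>
  also have "(\<integral>\<^sup>+x. \<integral>\<^sup>+v. (\<integral>\<^sup>+w. ennreal ((f (?Y x v) - f (?Y (?Y x v) w))\<^sup>2) \<partial>\<gamma>) \<partial>\<gamma> \<partial>\<gamma>) = dirichlet a f"
    using pcn_snd[OF a, of "\<lambda>y. \<integral>\<^sup>+w. ennreal ((f y - f (?Y y w))\<^sup>2) \<partial>\<gamma>"]
    by (simp add: pcn_def s_def)
  finally show ?thesis
    by (simp add: distrib_right[symmetric])
qed

lemma dirichlet_power_le:
  assumes a: "0 \<le> a" "a < 1" and f: "f \<in> borel_measurable E"
  shows "dirichlet (a ^ (2 ^ m)) f \<le> 4 ^ m * dirichlet a f"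
proof (induction m)
  case (Suc m)
  have "dirichlet (a ^ (2 ^ Suc m)) f = dirichlet ((a ^ (2 ^ m))\<^sup>2) f"
    by (simp add: power_mult[symmetric] mult.commute)
  also have "\<dots> \<le> 4 * dirichlet (a ^ (2 ^ m)) f"
    using a f by (intro dirichlet_square_le) (auto intro: power_Suc_less_one simp: power_less_one_iff)
  also have "\<dots> \<le> 4 * (4 ^ m * dirichlet a f)"
    by (intro mult_left_mono Suc.IH) auto
  finally show ?case by (simp add: mult.assoc)
qed simp

text \<open>Repeated squaring of a positive correlation never reaches 0, the correlation of
  independent points. A third vector closes the gap; its own noise has variance 1 - 2 c^2, which
  must be positive, and this limits c.\<close>

lemma variance_le_dirichlet_small:
  assumes c: "0 \<le> c" "c\<^sup>2 < 1/2" and [measurable]: "f \<in> borel_measurable E"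
  shows "(\<integral>\<^sup>+x. \<integral>\<^sup>+y. ennreal ((f x - f y)\<^sup>2) \<partial>\<gamma> \<partial>\<gamma>) \<le> 4 * dirichlet c f"
proof -
  define k where "k = sqrt (1 - 2 * c\<^sup>2)"
  have k: "k > 0" "k\<^sup>2 = 1 - 2 * c\<^sup>2" using c by (auto simp: k_def)
  have ck: "c\<^sup>2 + k\<^sup>2 = 1 - c\<^sup>2" using k by simp
  \<comment> \<open>\<open>mid\<close> has correlation \<open>c\<close> with each of the independent points \<open>x\<close>, \<open>y\<close>\<close>
  define mid where "mid x y w = lincomb d c x 1 (lincomb d c y k w)" for x y w
  have [measurable (raw)]: "(\<lambda>p. mid (f p) (g p) (h p)) \<in> N \<rightarrow>\<^sub>M E"
    if [measurable]: "f \<in> N \<rightarrow>\<^sub>M E" "g \<in> N \<rightarrow>\<^sub>M E" "h \<in> N \<rightarrow>\<^sub>M E" for f g h and N :: "'c measure"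
    unfolding mid_def by measurable
  have mid_sym: "mid x y w = mid y x w" for x y w
    unfolding mid_def by (intro euclidean_borel_eqI[of _ d]) auto
  have one: "(\<integral>\<^sup>+x. \<integral>\<^sup>+y. \<integral>\<^sup>+w. ennreal ((f x - f (mid x y w))\<^sup>2) \<partial>\<gamma> \<partial>\<gamma> \<partial>\<gamma>) = dirichlet c f"
    unfolding mid_def pcn_def
  proof (rule nn_integral_cong)
    fix x assume "x \<in> space \<gamma>"
    then have xE [measurable]: "x \<in> space E" by simp
    show "(\<integral>\<^sup>+y. \<integral>\<^sup>+w. ennreal ((f x - f (lincomb d c x 1 (lincomb d c y k w)))\<^sup>2) \<partial>\<gamma> \<partial>\<gamma>) =
      (\<integral>\<^sup>+w. ennreal ((f x - f (lincomb d c x (sqrt (1 - c\<^sup>2)) w))\<^sup>2) \<partial>\<gamma>)"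
      using k ck by (intro gaussian_sum_shift xE) auto
  qed
  \<comment> \<open>Fubini and the symmetry of \<open>mid\<close> in its first two arguments
    exchange the roles of x and y.\<close>
  have "(\<integral>\<^sup>+x. \<integral>\<^sup>+y. \<integral>\<^sup>+w. ennreal ((f (mid x y w) - f y)\<^sup>2) \<partial>\<gamma> \<partial>\<gamma> \<partial>\<gamma>) =
    (\<integral>\<^sup>+y. \<integral>\<^sup>+x. \<integral>\<^sup>+w. ennreal ((f (mid x y w) - f y)\<^sup>2) \<partial>\<gamma> \<partial>\<gamma> \<partial>\<gamma>)"
    by (rule nn_integral_Fubini_gaussian) measurable
  also have "\<dots> = dirichlet c f"
    by (subst one[symmetric]) (simp add: mid_sym power2_commute)
  finally have two: "(\<integral>\<^sup>+x. \<integral>\<^sup>+y. \<integral>\<^sup>+w. ennreal ((f (mid x y w) - f y)\<^sup>2) \<partial>\<gamma> \<partial>\<gamma> \<partial>\<gamma>) = dirichlet c f" .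
  have "(\<integral>\<^sup>+x. \<integral>\<^sup>+y. ennreal ((f x - f y)\<^sup>2) \<partial>\<gamma> \<partial>\<gamma>) =
    (\<integral>\<^sup>+x. \<integral>\<^sup>+y. \<integral>\<^sup>+w. ennreal ((f x - f y)\<^sup>2) \<partial>\<gamma> \<partial>\<gamma> \<partial>\<gamma>)"
    by (simp add: emeasure_space_1)
  also have "\<dots> \<le> (\<integral>\<^sup>+x. \<integral>\<^sup>+y. \<integral>\<^sup>+w. 2 * ennreal ((f x - f (mid x y w))\<^sup>2) +
      2 * ennreal ((f (mid x y w) - f y)\<^sup>2) \<partial>\<gamma> \<partial>\<gamma> \<partial>\<gamma>)"
    by (intro nn_integral_mono sq_diff_triangle)
  also have "\<dots> = 2 * (\<integral>\<^sup>+x. \<integral>\<^sup>+y. \<integral>\<^sup>+w. ennreal ((f x - f (mid x y w))\<^sup>2) \<partial>\<gamma> \<partial>\<gamma> \<partial>\<gamma>) +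
      2 * (\<integral>\<^sup>+x. \<integral>\<^sup>+y. \<integral>\<^sup>+w. ennreal ((f (mid x y w) - f y)\<^sup>2) \<partial>\<gamma> \<partial>\<gamma> \<partial>\<gamma>)"
  proof -
    have "(\<integral>\<^sup>+w. 2 * ennreal ((f x - f (mid x y w))\<^sup>2) + 2 * ennreal ((f (mid x y w) - f y)\<^sup>2) \<partial>\<gamma>) =
      2 * (\<integral>\<^sup>+w. ennreal ((f x - f (mid x y w))\<^sup>2) \<partial>\<gamma>) + 2 * (\<integral>\<^sup>+w. ennreal ((f (mid x y w) - f y)\<^sup>2) \<partial>\<gamma>)"
      if [measurable]: "x \<in> space E" "y \<in> space E" for x y
      by (subst nn_integral_add, measurable) (simp add: nn_integral_cmult)
    then have "(\<integral>\<^sup>+x. \<integral>\<^sup>+y. \<integral>\<^sup>+w. 2 * ennreal ((f x - f (mid x y w))\<^sup>2) +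
        2 * ennreal ((f (mid x y w) - f y)\<^sup>2) \<partial>\<gamma> \<partial>\<gamma> \<partial>\<gamma>) =
      (\<integral>\<^sup>+x. \<integral>\<^sup>+y. 2 * (\<integral>\<^sup>+w. ennreal ((f x - f (mid x y w))\<^sup>2) \<partial>\<gamma>) +
        2 * (\<integral>\<^sup>+w. ennreal ((f (mid x y w) - f y)\<^sup>2) \<partial>\<gamma>) \<partial>\<gamma> \<partial>\<gamma>)"
      by (intro nn_integral_cong) simp
    also have "\<dots> = 2 * (\<integral>\<^sup>+x. \<integral>\<^sup>+y. \<integral>\<^sup>+w. ennreal ((f x - f (mid x y w))\<^sup>2) \<partial>\<gamma> \<partial>\<gamma> \<partial>\<gamma>) +
      2 * (\<integral>\<^sup>+x. \<integral>\<^sup>+y. \<integral>\<^sup>+w. ennreal ((f (mid x y w) - f y)\<^sup>2) \<partial>\<gamma> \<partial>\<gamma> \<partial>\<gamma>)"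
      by (rule nn_integral_gaussian_add2) measurable
    finally show ?thesis .
  qed
  also have "\<dots> = 4 * dirichlet c f"
    unfolding one two by (simp add: distrib_right[symmetric])
  finally show ?thesis .
qed

lemma variance_le_dirichlet:
  assumes a: "0 \<le> a" "a < 1" and m: "(a ^ (2 ^ m))\<^sup>2 < 1/2" and f: "f \<in> borel_measurable E"
  shows "(\<integral>\<^sup>+x. \<integral>\<^sup>+y. ennreal ((f x - f y)\<^sup>2) \<partial>\<gamma> \<partial>\<gamma>) \<le> 4 ^ Suc m * dirichlet a f"
proof -
  have "(\<integral>\<^sup>+x. \<integral>\<^sup>+y. ennreal ((f x - f y)\<^sup>2) \<partial>\<gamma> \<partial>\<gamma>) \<le> 4 * dirichlet (a ^ (2 ^ m)) f"
    using a m f by (intro variance_le_dirichlet_small) auto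
  also have "\<dots> \<le> 4 * (4 ^ m * dirichlet a f)"
    using a f by (intro mult_left_mono dirichlet_power_le) auto
  finally show ?thesis by (simp add: mult.assoc)
qed

end

subsection \<open>Resampling the radius\<close>

text \<open>The value at t = 0 agrees with the density in \<open>gamma_distribution\<close> because
  \<open>0 powr x = 0\<close>; setting it to 0 outright makes almost sure positivity
  immediate.\<close>

definition gamma_density :: "real \<Rightarrow> real \<Rightarrow> real \<Rightarrow> real" where
  "gamma_density k \<beta> t = (if t \<le> 0 then 0 else \<beta> powr k / Gamma k * t powr (k - 1) * exp (- \<beta> * t))"

lemma gamma_distribution_eq: "gamma_distribution k \<beta> = density lborel (\<lambda>t. ennreal (gamma_density k \<beta> t))"
  unfolding gamma_distribution_def gamma_density_def
  by (intro arg_cong[where f="density lborel"] ext) auto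

lemma measurable_gamma_density [measurable (raw)]:
  assumes [measurable]: "\<beta> \<in> borel_measurable M" "t \<in> borel_measurable M"
  shows "(\<lambda>x. gamma_density k (\<beta> x) (t x)) \<in> borel_measurable M"
  unfolding gamma_density_def by measurable

lemma gamma_density_nonneg: "k > 0 \<Longrightarrow> gamma_density k \<beta> t \<ge> 0"
  by (auto simp: gamma_density_def intro!: mult_nonneg_nonneg divide_nonneg_nonneg less_imp_le[OF Gamma_real_pos])

lemma sets_gamma_distribution [simp, measurable_cong]: "sets (gamma_distribution k \<beta>) = sets borel"
  by (simp add: gamma_distribution_def)

lemma space_gamma_distribution [simp]: "space (gamma_distribution k \<beta>) = UNIV"
  by (simp add: gamma_distribution_def)

lemma nn_integral_gamma_distribution:
  assumes [measurable]: "F \<in> borel_measurable borel"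
  shows "(\<integral>\<^sup>+t. F t \<partial>gamma_distribution k \<beta>) = (\<integral>\<^sup>+t. ennreal (gamma_density k \<beta> t) * F t \<partial>lborel)"
  unfolding gamma_distribution_eq by (rule nn_integral_density) measurable

lemma AE_gamma_distribution_pos: "AE t in gamma_distribution k \<beta>. t > 0"
  unfolding gamma_distribution_eq by (subst AE_density) (auto simp: gamma_density_def)

text \<open>This turns a state-dependent rate into a deterministic rescaling of one fixed random
  variable. It also reduces the normalisation to rate 1, where it is Euler's integral.\<close>

lemma gamma_distribution_scale:
  assumes k: "k > 0" and \<beta>: "\<beta> > 0"
  shows "gamma_distribution k \<beta> = distr (gamma_distribution k 1) borel (\<lambda>t. t / \<beta>)"
proof (rule measure_eqI)
  fix A assume "A \<in> sets (gamma_distribution k \<beta>)"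
  then have [measurable]: "A \<in> sets borel" by simp
  have dens: "1 / \<beta> * gamma_density k \<beta> (t / \<beta>) = gamma_density k 1 t" for t
  proof (cases "t \<le> 0")
    case False
    have "\<beta> powr k = \<beta> * \<beta> powr (k - 1)"
      using \<beta> by (simp add: powr_mult_base)
    moreover have "(t / \<beta>) powr (k - 1) = t powr (k - 1) / \<beta> powr (k - 1)"
      using False \<beta> by (simp add: powr_divide)
    ultimately show ?thesis
      using False \<beta> by (simp add: gamma_density_def not_le divide_le_0_iff)
  qed (use \<beta> in \<open>auto simp: gamma_density_def divide_le_0_iff\<close>)
  have "emeasure (gamma_distribution k \<beta>) A = (\<integral>\<^sup>+t. ennreal (gamma_density k \<beta> t) * indicator A t \<partial>lborel)"
    unfolding gamma_distribution_eq by (subst emeasure_density) auto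
  also have "\<dots> = ennreal \<bar>1 / \<beta>\<bar> * (\<integral>\<^sup>+t. ennreal (gamma_density k \<beta> (0 + 1 / \<beta> * t)) * indicator A (0 + 1 / \<beta> * t) \<partial>lborel)"
    using \<beta> by (intro nn_integral_real_affine) auto
  also have "\<dots> = (\<integral>\<^sup>+t. ennreal (1 / \<beta>) * (ennreal (gamma_density k \<beta> (t / \<beta>)) * indicator A (t / \<beta>)) \<partial>lborel)"
    using \<beta> by (subst nn_integral_cmult) auto
  also have "\<dots> = (\<integral>\<^sup>+t. ennreal (gamma_density k 1 t) * indicator A (t / \<beta>) \<partial>lborel)"
  proof (rule nn_integral_cong)
    fix t
    have "ennreal (1 / \<beta>) * ennreal (gamma_density k \<beta> (t / \<beta>)) = ennreal (gamma_density k 1 t)"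
      using \<beta> k by (simp only: dens[of t, symmetric] ennreal_mult gamma_density_nonneg zero_le_divide_1_iff less_imp_le)
    then show "ennreal (1 / \<beta>) * (ennreal (gamma_density k \<beta> (t / \<beta>)) * indicator A (t / \<beta>)) =
      ennreal (gamma_density k 1 t) * indicator A (t / \<beta>)"
      by (simp only: mult.assoc[symmetric])
  qed
  also have "\<dots> = (\<integral>\<^sup>+t. indicator A (t / \<beta>) \<partial>gamma_distribution k 1)"
    by (subst nn_integral_gamma_distribution) auto
  also have "\<dots> = emeasure (distr (gamma_distribution k 1) borel (\<lambda>t. t / \<beta>)) A"
    by (subst nn_integral_distr[symmetric, of _ _ borel "indicator A"]) auto
  finally show "emeasure (gamma_distribution k \<beta>) A = emeasure (distr (gamma_distribution k 1) borel (\<lambda>t. t / \<beta>)) A" .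
qed simp

lemma prob_space_gamma_distribution:
  assumes k: "k > 0" and \<beta>: "\<beta> > 0"
  shows "prob_space (gamma_distribution k \<beta>)"
proof -
  have "emeasure (gamma_distribution k 1) UNIV = (\<integral>\<^sup>+t. ennreal (gamma_density k 1 t) * 1 \<partial>lborel)"
    using nn_integral_gamma_distribution[of "\<lambda>_. 1" k 1] by simp
  also have "\<dots> = (\<integral>\<^sup>+t. ennreal (1 / Gamma k) * ennreal (indicator {0..} t * t powr (k - 1) / exp t) \<partial>lborel)"
    using k less_imp_neq[OF Gamma_real_pos[OF k]] by (intro nn_integral_cong)
      (auto simp: gamma_density_def indicator_def ennreal_mult[symmetric] exp_minus field_simps)
  also have "\<dots> = ennreal (1 / Gamma k) * ennreal (Gamma k)"
    using k by (subst nn_integral_cmult) (auto simp: Gamma_conv_nn_integral_real)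
  also have "\<dots> = 1"
    using less_imp_neq[OF Gamma_real_pos[OF k]] k by (simp add: ennreal_mult[symmetric])
  finally interpret prob_space "gamma_distribution k 1"
    by (intro prob_spaceI) simp
  show ?thesis
    unfolding gamma_distribution_scale[OF assms] by (rule prob_space_distr) simp
qed

section \<open>The joint law of a Gaussian direction and a resampled radius\<close>

context diag_gaussian
begin

lemma AE_gaussian_coord:
  assumes "j < d"
  shows "AE x in \<gamma>. x j \<noteq> 0"
proof -
  let ?M = "\<lambda>i. density lborel (normal_density 0 (sqrt (lam i)))"
  have "AE t in ?M j. t \<noteq> 0"
    using AE_lborel_singleton[of 0] by (subst AE_density) auto
  then show ?thesis
    unfolding gaussian_diag_def using assms lam_pos
    by (intro AE_PiM_component[where P="\<lambda>t. t \<noteq> 0"] prob_space_normal_density) auto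
qed

lemma inv_quadratic_form_pos:
  assumes "j < d" "x j \<noteq> 0"
  shows "inv_quadratic_form lam d x > 0"
  unfolding inv_quadratic_form_def using assms lam_pos
  by (intro sum_pos2[of _ j]) (auto intro!: divide_nonneg_nonneg simp: less_imp_le)

text \<open>Discards the origin, where the Gamma rate vanishes and the radial projection takes its
  default value.\<close>

lemma AE_gaussian_inv_quadratic_form_pos: "d \<ge> 1 \<Longrightarrow> AE x in \<gamma>. inv_quadratic_form lam d x > 0"
  using AE_gaussian_coord[of 0] by (auto elim!: eventually_mono intro: inv_quadratic_form_pos[of 0])

lemma inv_quadratic_form_scale:
  "inv_quadratic_form lam d (lincomb d c x 0 x) = c\<^sup>2 * inv_quadratic_form lam d x"
  unfolding inv_quadratic_form_def by (simp add: sum_distrib_left power_mult_distrib)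

text \<open>The inverse Gamma density of shape d/2 and scale q/2. It arises as the conditional
  density of the squared factor v given the resampled vector y = sqrt v x, with q the quadratic form
  of y.\<close>

definition inverse_gamma_density :: "real \<Rightarrow> real \<Rightarrow> real" where
  "inverse_gamma_density q v = (if q > 0 \<and> v > 0 then
     (q / 2) powr (d / 2) / Gamma (d / 2) * v powr (- (d / 2) - 1) * exp (- q / (2 * v)) else 0)"

lemma measurable_inverse_gamma_density [measurable (raw)]:
  assumes [measurable]: "f \<in> borel_measurable M" "g \<in> borel_measurable M"
  shows "(\<lambda>x. inverse_gamma_density (f x) (g x)) \<in> borel_measurable M"
  unfolding inverse_gamma_density_def by measurable

lemma inverse_gamma_density_nonneg: "d \<ge> 1 \<Longrightarrow> inverse_gamma_density q v \<ge> 0"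
  by (auto simp: inverse_gamma_density_def intro!: mult_nonneg_nonneg divide_nonneg_nonneg less_imp_le[OF Gamma_real_pos])

text \<open>The substitution of q v for v removes q. Only this independence is needed, since it
  makes the mass a constant factor in the resampling identity.\<close>

lemma inverse_gamma_mass:
  assumes d: "d \<ge> 1" and q: "q > 0"
  shows "(\<integral>\<^sup>+v. ennreal (inverse_gamma_density q v) \<partial>lborel) = (\<integral>\<^sup>+v. ennreal (inverse_gamma_density 1 v) \<partial>lborel)"
proof -
  have "q * inverse_gamma_density q (q * v) = inverse_gamma_density 1 v" for v
  proof (cases "v > 0")
    case True
    have "q * q powr (d / 2) * q powr (- (d / 2) - 1) = 1"
      using q by (simp add: powr_mult_base powr_add[symmetric])
    moreover have "(q * v) powr (- (d / 2) - 1) = q powr (- (d / 2) - 1) * v powr (- (d / 2) - 1)"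
      using q True by (simp add: powr_mult)
    moreover have "(q / 2) powr (d / 2) = q powr (d / 2) * (1 / 2) powr (d / 2)"
      using q by (simp add: powr_mult[symmetric])
    ultimately show ?thesis
      using q True by (simp add: inverse_gamma_density_def)
  qed (use q in \<open>auto simp: inverse_gamma_density_def zero_less_mult_iff\<close>)
  then have "(\<integral>\<^sup>+v. ennreal (inverse_gamma_density 1 v) \<partial>lborel) =
    (\<integral>\<^sup>+v. ennreal q * ennreal (inverse_gamma_density q (0 + q * v)) \<partial>lborel)"
    using q by (intro nn_integral_cong) (simp add: ennreal_mult'[symmetric])
  also have "\<dots> = ennreal \<bar>q\<bar> * (\<integral>\<^sup>+v. ennreal (inverse_gamma_density q (0 + q * v)) \<partial>lborel)"
    using q by (subst nn_integral_cmult) auto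
  also have "\<dots> = (\<integral>\<^sup>+v. ennreal (inverse_gamma_density q v) \<partial>lborel)"
    using q by (intro nn_integral_real_affine[symmetric]) auto
  finally show ?thesis by simp
qed

text \<open>Write Q for the quadratic form of y, so that y / sqrt v has form Q / v. The Gaussian
  factor at y / sqrt v is exp (- Q / (2 v)), and the Gamma factor with rate Q / (2 v) at v is exp (-
  Q / 2): the two exponentials trade roles, and the second is the Gaussian factor at y.\<close>

lemma gaussian_radial_density_swap:
  assumes d: "d \<ge> 1" and v: "v > 0" and q: "inv_quadratic_form lam d y > 0"
  shows "(1 / sqrt v) ^ d * (gauss_density lam d (lincomb d 0 t (1 / sqrt v) y) *
      gamma_density (d / 2) (inv_quadratic_form lam d (lincomb d 0 t (1 / sqrt v) y) / 2) v) =
    gauss_density lam d y * inverse_gamma_density (inv_quadratic_form lam d y) v"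
proof -
  define Q where "Q = inv_quadratic_form lam d y"
  have Q: "inv_quadratic_form lam d (lincomb d 0 t (1 / sqrt v) y) = Q / v"
    using v unfolding Q_def inv_quadratic_form_def
    by (simp add: sum_divide_distrib power_divide field_simps)
  \<comment> \<open>W = v^(-d/2) occurs twice: as the Jacobian of the scaling and in the power of
    the rate Q / (2 v). Once the powers are named, the identity is plain commutativity.\<close>
  define P V W Z where "P = (Q / 2) powr (d / 2)" and "V = v powr (d / 2 - 1)"
    and "W = v powr (- (d / 2))" and "Z = sqrt ((2 * pi) ^ d * (\<Prod>j<d. lam j))"
  have W: "(1 / sqrt v) ^ d = W"
  proof -
    have "(1 / sqrt v) ^ d = (v powr (- 1 / 2)) ^ d"
      using v by (simp add: powr_half_sqrt[symmetric] powr_minus_divide)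
    also have "\<dots> = v powr (- (d / 2))"
      using v by (simp add: powr_realpow[symmetric] powr_powr)
    finally show ?thesis by (simp add: W_def)
  qed
  have PW: "(Q / v / 2) powr (d / 2) = P * W"
  proof -
    have "(Q / v / 2) powr (d / 2) = ((Q / 2) / v) powr (d / 2)"
      by (simp add: mult.commute)
    also have "\<dots> = P * W"
      using v q by (simp add: P_def W_def Q_def powr_divide powr_minus_divide powr_mult)
    finally show ?thesis .
  qed
  have VWW: "v powr (- (d / 2) - 1) = V * W * W"
    unfolding V_def W_def powr_add[symmetric] by (rule arg_cong[where f="(powr) v"]) simp
  have "gauss_density lam d (lincomb d 0 t (1 / sqrt v) y) = exp (- Q / (2 * v)) / Z"
    unfolding gauss_density_def Q Z_def by (simp add: mult.commute)
  moreover have "gauss_density lam d y = exp (- Q / 2) / Z"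
    unfolding gauss_density_def Q_def Z_def by simp
  moreover have "gamma_density (d / 2) (Q / v / 2) v = P * W / Gamma (d / 2) * V * exp (- Q / 2)"
    unfolding gamma_density_def PW V_def using v by simp
  moreover have "inverse_gamma_density Q v = P / Gamma (d / 2) * (V * W * W) * exp (- Q / (2 * v))"
    unfolding inverse_gamma_density_def VWW P_def using v q by (simp add: Q_def)
  moreover have "W * (e1 / Z * (P * W / G * V * e2)) = e2 / Z * (P / G * (V * W * W) * e1)" for e1 e2 G :: real
    by (simp add: divide_inverse mult_ac)
  ultimately show ?thesis
    unfolding W Q Q_def[symmetric] by (simp only:)
qed

text \<open>Given x, the factor v = t / (q/2), with q the quadratic form of x, is Gamma with rate
  q/2. In the variables y = sqrt v x and v the joint density is the Gaussian density of y times a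
  density in v whose mass does not depend on y, so y is Gaussian. Using x itself instead of its
  direction changes nothing, since the rate scales with the square of the length.\<close>

lemma gaussian_radial_resampling:
  assumes d: "d \<ge> 1" and [measurable]: "F \<in> borel_measurable E"
  shows "(\<integral>\<^sup>+x. \<integral>\<^sup>+t. F (lincomb d (sqrt (t / (inv_quadratic_form lam d x / 2))) x 0 x)
    \<partial>gamma_distribution (d / 2) 1 \<partial>\<gamma>) = (\<integral>\<^sup>+x. F x \<partial>\<gamma>)"
proof -
  let ?q = "inv_quadratic_form lam d" and ?g = "gauss_density lam d"
  let ?I = "\<lambda>F. \<integral>\<^sup>+x. \<integral>\<^sup>+t. F (lincomb d (sqrt (t / (?q x / 2))) x 0 x)
    \<partial>gamma_distribution (d / 2) 1 \<partial>\<gamma>"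
  define \<kappa> where "\<kappa> = (\<integral>\<^sup>+v. ennreal (inverse_gamma_density 1 v) \<partial>lborel)"
  \<comment> \<open>The guard changes only a null set and makes the density vanish exactly where
    \<open>inverse_gamma_density\<close> does, so the density swap holds for every y.\<close>
  let ?D = "\<lambda>x v. if ?q x > 0 then gamma_density (d / 2) (?q x / 2) v else 0"
  interpret pair_sigma_finite lborel \<Lambda> by standard
  have main: "?I F = \<kappa> * (\<integral>\<^sup>+x. F x \<partial>\<gamma>)" if [measurable]: "F \<in> borel_measurable E" for F
  proof -
    have "?I F = (\<integral>\<^sup>+x. \<integral>\<^sup>+v. ennreal (?D x v) * F (lincomb d (sqrt v) x 0 x) \<partial>lborel \<partial>\<gamma>)"
    proof -
      have "(\<integral>\<^sup>+t. F (lincomb d (sqrt (t / (?q x / 2))) x 0 x) \<partial>gamma_distribution (d / 2) 1) =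
        (\<integral>\<^sup>+v. ennreal (?D x v) * F (lincomb d (sqrt v) x 0 x) \<partial>lborel)"
        if x: "?q x > 0" and [measurable]: "x \<in> space E" for x
      proof -
        have "(\<integral>\<^sup>+t. F (lincomb d (sqrt (t / (?q x / 2))) x 0 x) \<partial>gamma_distribution (d / 2) 1) =
          (\<integral>\<^sup>+v. F (lincomb d (sqrt v) x 0 x) \<partial>gamma_distribution (d / 2) (?q x / 2))"
          using x d by (subst gamma_distribution_scale[of "d / 2" "?q x / 2"]) (auto simp: nn_integral_distr)
        also have "\<dots> = (\<integral>\<^sup>+v. ennreal (?D x v) * F (lincomb d (sqrt v) x 0 x) \<partial>lborel)"
          using x by (subst nn_integral_gamma_distribution) auto
        finally show ?thesis .
      qed
      then show ?thesis
        using AE_gaussian_inv_quadratic_form_pos[OF d] AE_space[of \<gamma>]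
        by (intro nn_integral_cong_AE) (auto elim: eventually_elim2)
    qed
    also have "\<dots> = (\<integral>\<^sup>+x. ennreal (?g x) * (\<integral>\<^sup>+v. ennreal (?D x v) * F (lincomb d (sqrt v) x 0 x) \<partial>lborel) \<partial>\<Lambda>)"
      by (rule nn_integral_gaussian) measurable
    also have "\<dots> = (\<integral>\<^sup>+x. \<integral>\<^sup>+v. ennreal (?g x) * (ennreal (?D x v) * F (lincomb d (sqrt v) x 0 x)) \<partial>lborel \<partial>\<Lambda>)"
    proof (rule nn_integral_cong)
      fix x assume "x \<in> space \<Lambda>"
      then have [measurable]: "x \<in> space E" by (simp add: space_PiM_lborel_euclidean)
      show "ennreal (?g x) * (\<integral>\<^sup>+v. ennreal (?D x v) * F (lincomb d (sqrt v) x 0 x) \<partial>lborel) =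
        (\<integral>\<^sup>+v. ennreal (?g x) * (ennreal (?D x v) * F (lincomb d (sqrt v) x 0 x)) \<partial>lborel)"
        by (rule nn_integral_cmult[symmetric]) measurable
    qed
    also have "\<dots> = (\<integral>\<^sup>+v. \<integral>\<^sup>+x. ennreal (?g x) * (ennreal (?D x v) * F (lincomb d (sqrt v) x 0 x)) \<partial>\<Lambda> \<partial>lborel)"
      by (rule Fubini') measurable
    also have "\<dots> = (\<integral>\<^sup>+v. \<integral>\<^sup>+y. ennreal (?g y * inverse_gamma_density (?q y) v) * F y \<partial>\<Lambda> \<partial>lborel)"
    proof (rule nn_integral_cong)
      fix v :: real
      show "(\<integral>\<^sup>+x. ennreal (?g x) * (ennreal (?D x v) * F (lincomb d (sqrt v) x 0 x)) \<partial>\<Lambda>) =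
        (\<integral>\<^sup>+y. ennreal (?g y * inverse_gamma_density (?q y) v) * F y \<partial>\<Lambda>)"
      proof (cases "v > 0")
        case True
        define c where "c = 1 / sqrt v"
        have c: "c > 0" using True by (simp add: c_def)
        \<comment> \<open>A placeholder: the substitution rule carries a translation b t, which is
          switched off by b = 0 but still needs a vector t.\<close>
        define z :: "nat \<Rightarrow> real" where "z = (\<lambda>j\<in>{..<d}. 0)"
        have [measurable]: "z \<in> space E" by (simp add: z_def space_euclidean_borel)
        have undo: "lincomb d (sqrt v) (lincomb d 0 z c y) 0 (lincomb d 0 z c y) = y" if "y \<in> space E" for y
          using that True by (intro euclidean_borel_eqI[of _ d]) (auto simp: c_def)
        have pos: "?q (lincomb d 0 z c y) > 0 \<longleftrightarrow> ?q y > 0" for y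
        proof -
          have "lincomb d 0 z c y = lincomb d c y 0 y"
            by (intro euclidean_borel_eqI[of _ d]) auto
          then show ?thesis using c by (simp add: inv_quadratic_form_scale zero_less_mult_iff)
        qed
        have "(\<integral>\<^sup>+x. ennreal (?g x) * (ennreal (?D x v) * F (lincomb d (sqrt v) x 0 x)) \<partial>\<Lambda>) =
          ennreal (c ^ d) * (\<integral>\<^sup>+y. ennreal (?g (lincomb d 0 z c y)) * (ennreal (?D (lincomb d 0 z c y) v) *
            F (lincomb d (sqrt v) (lincomb d 0 z c y) 0 (lincomb d 0 z c y))) \<partial>\<Lambda>)"
          using c by (intro nn_integral_shift_scale) auto
        also have "\<dots> = (\<integral>\<^sup>+y. ennreal (c ^ d) * (ennreal (?g (lincomb d 0 z c y)) * (ennreal (?D (lincomb d 0 z c y) v) *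
            F (lincomb d (sqrt v) (lincomb d 0 z c y) 0 (lincomb d 0 z c y)))) \<partial>\<Lambda>)"
          by (rule nn_integral_cmult[symmetric]) measurable
        also have "\<dots> = (\<integral>\<^sup>+y. ennreal (?g y * inverse_gamma_density (?q y) v) * F y \<partial>\<Lambda>)"
        proof (rule nn_integral_cong)
          fix y assume "y \<in> space \<Lambda>"
          then have y: "y \<in> space E" by (simp add: space_PiM_lborel_euclidean)
          have "c ^ d * (?g (lincomb d 0 z c y) * ?D (lincomb d 0 z c y) v) = ?g y * inverse_gamma_density (?q y) v"
            using gaussian_radial_density_swap[OF d True, of y z] pos[of y]
            by (auto simp: c_def inverse_gamma_density_def)
          then show "ennreal (c ^ d) * (ennreal (?g (lincomb d 0 z c y)) * (ennreal (?D (lincomb d 0 z c y) v) *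
            F (lincomb d (sqrt v) (lincomb d 0 z c y) 0 (lincomb d 0 z c y)))) =
            ennreal (?g y * inverse_gamma_density (?q y) v) * F y"
            using c d by (simp add: undo[OF y] mult.assoc[symmetric] ennreal_mult[symmetric] gauss_density_nonneg gamma_density_nonneg)
        qed
        finally show ?thesis .
      next
        case False
        then have "gamma_density k \<beta> v = 0" "inverse_gamma_density q v = 0" for k \<beta> q
          by (auto simp: gamma_density_def inverse_gamma_density_def)
        then show ?thesis by (simp cong: if_cong)
      qed
    qed
    also have "\<dots> = (\<integral>\<^sup>+y. \<integral>\<^sup>+v. ennreal (?g y * inverse_gamma_density (?q y) v) * F y \<partial>lborel \<partial>\<Lambda>)"
      by (rule Fubini'[symmetric]) measurable
    also have "\<dots> = (\<integral>\<^sup>+y. ennreal (?g y) * (F y * (\<integral>\<^sup>+v. ennreal (inverse_gamma_density (?q y) v) \<partial>lborel)) \<partial>\<Lambda>)"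
    proof (rule nn_integral_cong)
      fix y
      have "(\<integral>\<^sup>+v. ennreal (?g y * inverse_gamma_density (?q y) v) * F y \<partial>lborel) =
        (\<integral>\<^sup>+v. (ennreal (?g y) * F y) * ennreal (inverse_gamma_density (?q y) v) \<partial>lborel)"
        by (simp add: ennreal_mult gauss_density_nonneg inverse_gamma_density_nonneg[OF d] mult_ac)
      then show "(\<integral>\<^sup>+v. ennreal (?g y * inverse_gamma_density (?q y) v) * F y \<partial>lborel) =
        ennreal (?g y) * (F y * (\<integral>\<^sup>+v. ennreal (inverse_gamma_density (?q y) v) \<partial>lborel))"
        by (simp add: nn_integral_cmult mult.assoc)
    qed
    also have "\<dots> = (\<integral>\<^sup>+y. F y * (\<integral>\<^sup>+v. ennreal (inverse_gamma_density (?q y) v) \<partial>lborel) \<partial>\<gamma>)"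
      by (rule nn_integral_gaussian[symmetric]) measurable
    also have "\<dots> = (\<integral>\<^sup>+y. \<kappa> * F y \<partial>\<gamma>)"
    proof -
      have "F y * (\<integral>\<^sup>+v. ennreal (inverse_gamma_density (?q y) v) \<partial>lborel) = \<kappa> * F y" if "?q y > 0" for y
        unfolding inverse_gamma_mass[OF d that] \<kappa>_def by (rule mult.commute)
      then show ?thesis
        using AE_gaussian_inv_quadratic_form_pos[OF d]
        by (intro nn_integral_cong_AE) (auto elim: eventually_mono)
    qed
    also have "\<dots> = \<kappa> * (\<integral>\<^sup>+x. F x \<partial>\<gamma>)"
      by (rule nn_integral_cmult) measurable
    finally show ?thesis .
  qed
  \<comment> \<open>\<open>F = 1\<close> determines the constant\<close>
  interpret G: prob_space "gamma_distribution (d / 2) 1"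
    using d by (intro prob_space_gamma_distribution) auto
  have "\<kappa> = 1"
    using main[of "\<lambda>_. 1"] G.emeasure_space_1 by simp
  then show ?thesis
    using main[of F] by simp
qed

end

subsection \<open>Operator norm and quadratic form\<close>

lemma L2_mult_integrable:
  assumes f: "f \<in> L2 M" and g: "g \<in> L2 M"
  shows "integrable M (\<lambda>x. f x * g x)"
proof (rule Bochner_Integration.integrable_bound)
  show "integrable M (\<lambda>x. (f x)\<^sup>2 + (g x)\<^sup>2)"
    using f g by (auto simp: L2_def)
  show "(\<lambda>x. f x * g x) \<in> borel_measurable M"
    using f g by (auto simp: L2_def)
  show "AE x in M. norm (f x * g x) \<le> norm ((f x)\<^sup>2 + (g x)\<^sup>2)"
  proof (rule AE_I2)
    fix x
    have "0 \<le> (\<bar>f x\<bar> - \<bar>g x\<bar>)\<^sup>2" by simp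
    then have "2 * (\<bar>f x\<bar> * \<bar>g x\<bar>) \<le> (f x)\<^sup>2 + (g x)\<^sup>2" by (simp add: power2_diff)
    moreover have "0 \<le> \<bar>f x\<bar> * \<bar>g x\<bar>" by simp
    ultimately have "\<bar>f x\<bar> * \<bar>g x\<bar> \<le> (f x)\<^sup>2 + (g x)\<^sup>2" by linarith
    then show "norm (f x * g x) \<le> norm ((f x)\<^sup>2 + (g x)\<^sup>2)"
      by (simp add: abs_mult)
  qed
qed

lemma L2_lincomb:
  assumes f: "f \<in> L2 M" and g: "g \<in> L2 M"
  shows "(\<lambda>x. a * f x + b * g x) \<in> L2 M"
proof -
  have "(\<lambda>x. (a * f x + b * g x)\<^sup>2) = (\<lambda>x. a\<^sup>2 * (f x)\<^sup>2 + 2 * a * b * (f x * g x) + b\<^sup>2 * (g x)\<^sup>2)"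
    by (auto simp: fun_eq_iff power2_eq_square algebra_simps)
  then show ?thesis
    using f g L2_mult_integrable[OF f g] by (auto simp: L2_def)
qed

lemma (in prob_space) L2_integrable: "f \<in> L2 M \<Longrightarrow> integrable M f"
  using L2_mult_integrable[of f M "\<lambda>_. 1"] by (simp add: L2_def)

text \<open>Jensen's inequality without an integrability hypothesis, because it is applied to f
  after one step from every single state, where square integrability need not hold. In that case the
  right side is \<infinity>.\<close>

lemma (in prob_space) sq_integral_le_nn_integral:
  fixes h :: "'a \<Rightarrow> real"
  assumes [measurable]: "h \<in> borel_measurable M"
  shows "ennreal ((\<integral>x. h x \<partial>M)\<^sup>2) \<le> (\<integral>\<^sup>+x. ennreal ((h x)\<^sup>2) \<partial>M)"
proof (cases "integrable M (\<lambda>x. (h x)\<^sup>2)")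
  case True
  then have h: "h \<in> L2 M" by (simp add: L2_def)
  define m where "m = (\<integral>x. h x \<partial>M)"
  have "0 \<le> (\<integral>x. (h x - m)\<^sup>2 \<partial>M)" by simp
  also have "\<dots> = (\<integral>x. (h x)\<^sup>2 - 2 * m * h x + m\<^sup>2 \<partial>M)"
    by (simp add: power2_diff algebra_simps)
  also have "\<dots> = (\<integral>x. (h x)\<^sup>2 \<partial>M) - m\<^sup>2"
    using True L2_integrable[OF h] by (simp add: prob_space m_def power2_eq_square)
  finally have "m\<^sup>2 \<le> (\<integral>x. (h x)\<^sup>2 \<partial>M)" by simp
  then show ?thesis
    using True by (simp add: nn_integral_eq_integral m_def ennreal_leI)
next
  case False
  then have "(\<integral>\<^sup>+x. ennreal ((h x)\<^sup>2) \<partial>M) = \<infinity>"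
    by (auto simp: integrable_iff_bounded less_top[symmetric])
  then show ?thesis by simp
qed

text \<open>Twice the variance as a mean square difference of independent copies, the form in which
  the coupling bound is available. The gap estimate for differences uses the mean-zero condition
  here.\<close>

lemma (in prob_space) nn_integral_sq_diff:
  assumes f: "f \<in> L2_0 M"
  shows "(\<integral>\<^sup>+x. \<integral>\<^sup>+y. ennreal ((f x - f y)\<^sup>2) \<partial>M \<partial>M) = 2 * (\<integral>\<^sup>+x. ennreal ((f x)\<^sup>2) \<partial>M)"
proof -
  have fL: "f \<in> L2 M" and f0: "(\<integral>x. f x \<partial>M) = 0" using f by (auto simp: L2_0_def)
  have [measurable]: "f \<in> borel_measurable M" and sq: "integrable M (\<lambda>x. (f x)\<^sup>2)"
    using fL by (auto simp: L2_def)
  note int = L2_integrable[OF fL]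
  have "(\<integral>\<^sup>+y. ennreal ((f x - f y)\<^sup>2) \<partial>M) = ennreal ((f x)\<^sup>2 + (\<integral>y. (f y)\<^sup>2 \<partial>M))" for x
  proof -
    have "(\<integral>\<^sup>+y. ennreal ((f x - f y)\<^sup>2) \<partial>M) = (\<integral>\<^sup>+y. ennreal ((f x)\<^sup>2 - 2 * f x * f y + (f y)\<^sup>2) \<partial>M)"
      by (simp add: power2_diff algebra_simps)
    also have "\<dots> = ennreal (\<integral>y. (f x)\<^sup>2 - 2 * f x * f y + (f y)\<^sup>2 \<partial>M)"
    proof (rule nn_integral_eq_integral)
      have "(f x)\<^sup>2 - 2 * f x * f y + (f y)\<^sup>2 = (f x - f y)\<^sup>2" for y
        by (simp add: power2_diff algebra_simps)
      then show "AE y in M. 0 \<le> (f x)\<^sup>2 - 2 * f x * f y + (f y)\<^sup>2" by simp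
    qed (use int sq in auto)
    also have "(\<integral>y. (f x)\<^sup>2 - 2 * f x * f y + (f y)\<^sup>2 \<partial>M) = (f x)\<^sup>2 + (\<integral>y. (f y)\<^sup>2 \<partial>M)"
      using int sq by (simp add: f0 prob_space)
    finally show ?thesis .
  qed
  then have "(\<integral>\<^sup>+x. \<integral>\<^sup>+y. ennreal ((f x - f y)\<^sup>2) \<partial>M \<partial>M) =
    (\<integral>\<^sup>+x. ennreal ((f x)\<^sup>2) + ennreal (\<integral>y. (f y)\<^sup>2 \<partial>M) \<partial>M)"
    by (simp add: ennreal_plus)
  also have "\<dots> = (\<integral>\<^sup>+x. ennreal ((f x)\<^sup>2) \<partial>M) + ennreal (\<integral>y. (f y)\<^sup>2 \<partial>M)"
    by (subst nn_integral_add) (auto simp: emeasure_space_1)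
  also have "ennreal (\<integral>y. (f y)\<^sup>2 \<partial>M) = (\<integral>\<^sup>+x. ennreal ((f x)\<^sup>2) \<partial>M)"
    using sq by (simp add: nn_integral_eq_integral)
  finally show ?thesis by (simp add: mult_2)
qed

text \<open>With the kernel given by a random map \<open>N\<close>, the joint law of a state and its
  successor is an image of the product of M and P. Reversibility makes this law symmetric, so the
  associated bilinear form is symmetric, and for such a form a two-sided bound on the diagonal
  bounds the norm. The condition \<beta> \<le> 1 keeps 1 - \<beta> admissible in
  \<open>L2_0_opnorm\<close>.\<close>

lemma L2_0_opnorm_le_of_quadratic_form:
  fixes M :: "'b measure" and P :: "'w measure"
  assumes "prob_space M" "prob_space P"
    and N [measurable]: "case_prod N \<in> M \<Otimes>\<^sub>M P \<rightarrow>\<^sub>M M"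
    and K: "\<And>x. x \<in> space M \<Longrightarrow> K x = distr P M (N x)"
    and reversible: "\<And>F. case_prod F \<in> borel_measurable (M \<Otimes>\<^sub>M M) \<Longrightarrow>
      (\<integral>\<^sup>+x. \<integral>\<^sup>+\<omega>. F x (N x \<omega>) \<partial>P \<partial>M) = (\<integral>\<^sup>+x. \<integral>\<^sup>+\<omega>. F (N x \<omega>) x \<partial>P \<partial>M)"
    and \<beta>: "0 \<le> \<beta>" "\<beta> \<le> 1"
    and diff: "\<And>f. f \<in> L2_0 M \<Longrightarrow> ennreal (2 * \<beta>) * (\<integral>\<^sup>+x. ennreal ((f x)\<^sup>2) \<partial>M) \<le>
      (\<integral>\<^sup>+x. \<integral>\<^sup>+\<omega>. ennreal ((f x - f (N x \<omega>))\<^sup>2) \<partial>P \<partial>M)"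
    and plus: "\<And>f. f \<in> L2_0 M \<Longrightarrow> ennreal (2 * \<beta>) * (\<integral>\<^sup>+x. ennreal ((f x)\<^sup>2) \<partial>M) \<le>
      (\<integral>\<^sup>+x. \<integral>\<^sup>+\<omega>. ennreal ((f x + f (N x \<omega>))\<^sup>2) \<partial>P \<partial>M)"
  shows "L2_0_opnorm M K \<le> ereal (1 - \<beta>)"
proof -
  interpret M: prob_space M by fact
  interpret P: prob_space P by fact
  interpret MP: pair_prob_space M P ..
  let ?Q = "M \<Otimes>\<^sub>M P"
  let ?N = "\<lambda>z. N (fst z) (snd z)"
  have N' [measurable]: "?N \<in> ?Q \<rightarrow>\<^sub>M M" using N by (simp add: case_prod_unfold)
  define b where "b f g = (\<integral>z. f (fst z) * g (?N z) \<partial>?Q)" for f g :: "'b \<Rightarrow> real"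
  have joint: "distr ?Q (M \<Otimes>\<^sub>M M) (\<lambda>z. (fst z, ?N z)) = distr ?Q (M \<Otimes>\<^sub>M M) (\<lambda>z. (?N z, fst z))"
  proof (rule measure_eqI)
    fix A assume "A \<in> sets (distr ?Q (M \<Otimes>\<^sub>M M) (\<lambda>z. (fst z, ?N z)))"
    then have [measurable]: "A \<in> sets (M \<Otimes>\<^sub>M M)" by simp
    have "emeasure (distr ?Q (M \<Otimes>\<^sub>M M) (\<lambda>z. (fst z, ?N z))) A = (\<integral>\<^sup>+z. indicator A (fst z, ?N z) \<partial>?Q)"
      by (subst nn_integral_distr[symmetric, of _ _ "M \<Otimes>\<^sub>M M" "indicator A"]) auto
    also have "\<dots> = (\<integral>\<^sup>+x. \<integral>\<^sup>+\<omega>. indicator A (x, N x \<omega>) \<partial>P \<partial>M)"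
      by (subst P.nn_integral_fst[symmetric]) auto
    also have "\<dots> = (\<integral>\<^sup>+x. \<integral>\<^sup>+\<omega>. indicator A (N x \<omega>, x) \<partial>P \<partial>M)"
      by (rule reversible[of "\<lambda>x y. indicator A (x, y)"]) simp
    also have "\<dots> = (\<integral>\<^sup>+z. indicator A (?N z, fst z) \<partial>?Q)"
      by (subst P.nn_integral_fst[symmetric]) auto
    also have "\<dots> = emeasure (distr ?Q (M \<Otimes>\<^sub>M M) (\<lambda>z. (?N z, fst z))) A"
      by (subst nn_integral_distr[symmetric, of _ _ "M \<Otimes>\<^sub>M M" "indicator A"]) auto
    finally show "emeasure (distr ?Q (M \<Otimes>\<^sub>M M) (\<lambda>z. (fst z, ?N z))) A =
      emeasure (distr ?Q (M \<Otimes>\<^sub>M M) (\<lambda>z. (?N z, fst z))) A" .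
  qed simp
  have distr_fst: "distr ?Q M fst = M"
    by (rule P.distr_pair_fst)
  \<comment> \<open>Invariance of M: a symmetric joint law has equal marginals.\<close>
  have distr_N: "distr ?Q M ?N = M"
  proof -
    have "distr ?Q M ?N = distr (distr ?Q (M \<Otimes>\<^sub>M M) (\<lambda>z. (fst z, ?N z))) M snd"
      by (subst distr_distr) (auto simp: comp_def)
    also have "\<dots> = distr ?Q M fst"
      unfolding joint by (subst distr_distr) (auto simp: comp_def)
    finally show ?thesis by (simp add: distr_fst)
  qed
  have L2_fst: "(\<lambda>z. f (fst z)) \<in> L2 ?Q" if "f \<in> L2 M" for f
    using that integrable_distr_eq[of fst ?Q M "\<lambda>x. (f x)\<^sup>2"] by (auto simp: L2_def distr_fst)
  have L2_N: "(\<lambda>z. f (?N z)) \<in> L2 ?Q" if "f \<in> L2 M" for f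
    using that integrable_distr_eq[OF N', of "\<lambda>x. (f x)\<^sup>2"] by (auto simp: L2_def distr_N)
  have int_fst: "(\<integral>z. f (fst z) \<partial>?Q) = (\<integral>x. f x \<partial>M)" if "f \<in> borel_measurable M" for f :: "'b \<Rightarrow> real"
    using that integral_distr[of fst ?Q M f] by (simp add: distr_fst)
  have int_N: "(\<integral>z. f (?N z) \<partial>?Q) = (\<integral>x. f x \<partial>M)" if "f \<in> borel_measurable M" for f :: "'b \<Rightarrow> real"
    using that integral_distr[OF N', of f] by (simp add: distr_N)
  have b_int: "integrable ?Q (\<lambda>z. f (fst z) * g (?N z))" if "f \<in> L2 M" "g \<in> L2 M" for f g
    by (rule L2_mult_integrable[OF L2_fst L2_N]) fact+
  have b_sym: "b f g = b g f" if "f \<in> L2 M" "g \<in> L2 M" for f g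
  proof -
    have [measurable]: "f \<in> borel_measurable M" "g \<in> borel_measurable M" using that by (auto simp: L2_def)
    have "b f g = (\<integral>p. f (fst p) * g (snd p) \<partial>distr ?Q (M \<Otimes>\<^sub>M M) (\<lambda>z. (fst z, ?N z)))"
      unfolding b_def by (subst integral_distr) auto
    also have "\<dots> = (\<integral>z. f (?N z) * g (fst z) \<partial>?Q)"
      unfolding joint by (subst integral_distr) auto
    finally show ?thesis by (simp add: b_def mult.commute)
  qed
  have kernel: "kernel_op K f x = (\<integral>\<omega>. f (N x \<omega>) \<partial>P)" if "x \<in> space M" "f \<in> borel_measurable M" for f x
    unfolding kernel_op_def K[OF that(1)] using that by (subst integral_distr) auto
  have kernel_meas: "kernel_op K f \<in> borel_measurable M" if [measurable]: "f \<in> borel_measurable M" for f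
  proof -
    have "(\<lambda>x. \<integral>\<omega>. f (N x \<omega>) \<partial>P) \<in> borel_measurable M" by measurable
    then show ?thesis using kernel[OF _ that] by (simp cong: measurable_cong)
  qed
  have kernel_sq: "(\<integral>\<^sup>+x. ennreal ((kernel_op K f x)\<^sup>2) \<partial>M) \<le> (\<integral>\<^sup>+x. ennreal ((f x)\<^sup>2) \<partial>M)"
    if [measurable]: "f \<in> borel_measurable M" for f
  proof -
    have "(\<integral>\<^sup>+x. ennreal ((kernel_op K f x)\<^sup>2) \<partial>M) \<le> (\<integral>\<^sup>+x. \<integral>\<^sup>+\<omega>. ennreal ((f (N x \<omega>))\<^sup>2) \<partial>P \<partial>M)"
      by (intro nn_integral_mono) (auto simp: kernel[OF _ that] intro!: P.sq_integral_le_nn_integral)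
    also have "\<dots> = (\<integral>\<^sup>+x. \<integral>\<^sup>+\<omega>. ennreal ((f x)\<^sup>2) \<partial>P \<partial>M)"
      by (rule reversible[symmetric, of "\<lambda>x y. ennreal ((f x)\<^sup>2)"]) simp
    finally show ?thesis by (simp add: P.emeasure_space_1)
  qed
  have kernel_L2: "kernel_op K f \<in> L2 M" if "f \<in> L2 M" for f
  proof -
    have f: "f \<in> borel_measurable M" "integrable M (\<lambda>x. (f x)\<^sup>2)" using that by (auto simp: L2_def)
    have "(\<integral>\<^sup>+x. ennreal ((kernel_op K f x)\<^sup>2) \<partial>M) < \<infinity>"
      using kernel_sq[OF f(1)] f(2) by (auto simp: integrable_iff_bounded elim: order_le_less_trans)
    then show ?thesis using kernel_meas[OF f(1)] by (auto simp: L2_def integrable_iff_bounded)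
  qed
  have pairing: "(\<integral>x. g x * kernel_op K f x \<partial>M) = b g f" if fg: "f \<in> L2 M" "g \<in> L2 M" for f g
  proof -
    have f: "f \<in> borel_measurable M" using fg by (auto simp: L2_def)
    have "b g f = (\<integral>x. \<integral>\<omega>. g x * f (N x \<omega>) \<partial>P \<partial>M)"
      unfolding b_def using MP.integral_fst'[OF b_int[OF fg(2,1)]] by simp
    also have "\<dots> = (\<integral>x. g x * kernel_op K f x \<partial>M)"
      by (intro Bochner_Integration.integral_cong) (auto simp: kernel[OF _ f])
    finally show ?thesis by simp
  qed
  have kernel_L2_0: "kernel_op K f \<in> L2_0 M" if "f \<in> L2_0 M" for f
  proof -
    have f: "f \<in> L2 M" "f \<in> borel_measurable M" "(\<integral>x. f x \<partial>M) = 0" using that by (auto simp: L2_0_def L2_def)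
    have "(\<lambda>_. 1) \<in> L2 M" by (simp add: L2_def)
    from pairing[OF f(1) this] have "(\<integral>x. kernel_op K f x \<partial>M) = 0"
      by (simp add: b_def int_N f)
    then show ?thesis using kernel_L2[OF f(1)] by (simp add: L2_0_def)
  qed
  define c where "c = 1 - \<beta>"
  have quad: "b u u \<le> c * (\<integral>x. (u x)\<^sup>2 \<partial>M)" "- b u u \<le> c * (\<integral>x. (u x)\<^sup>2 \<partial>M)" if u: "u \<in> L2_0 M" for u
  proof -
    have uL: "u \<in> L2 M" and [measurable]: "u \<in> borel_measurable M" and sq: "integrable M (\<lambda>x. (u x)\<^sup>2)"
      using u by (auto simp: L2_0_def L2_def)
    define U where "U = (\<integral>x. (u x)\<^sup>2 \<partial>M)"
    have U: "U \<ge> 0" "(\<integral>\<^sup>+x. ennreal ((u x)\<^sup>2) \<partial>M) = ennreal U"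
      using sq by (auto simp: U_def nn_integral_eq_integral)
    have i1: "integrable ?Q (\<lambda>z. (u (fst z))\<^sup>2)" using L2_fst[OF uL] by (simp add: L2_def)
    have i2: "integrable ?Q (\<lambda>z. (u (?N z))\<^sup>2)" using L2_N[OF uL] by (simp add: L2_def)
    have i3: "integrable ?Q (\<lambda>z. u (fst z) * u (?N z))" by (rule b_int[OF uL uL])
    have e: "(u (fst z) + \<sigma> * u (?N z))\<^sup>2 = (u (fst z))\<^sup>2 + (u (?N z))\<^sup>2 + 2 * \<sigma> * (u (fst z) * u (?N z))"
      if "\<sigma>\<^sup>2 = 1" for z \<sigma>
      using that by (simp add: power2_sum power_mult_distrib)
    have expand: "(\<integral>\<^sup>+x. \<integral>\<^sup>+\<omega>. ennreal ((u x + \<sigma> * u (N x \<omega>))\<^sup>2) \<partial>P \<partial>M) = ennreal (2 * U + 2 * \<sigma> * b u u)"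
      if "\<sigma>\<^sup>2 = 1" for \<sigma>
    proof -
      have "(\<integral>\<^sup>+x. \<integral>\<^sup>+\<omega>. ennreal ((u x + \<sigma> * u (N x \<omega>))\<^sup>2) \<partial>P \<partial>M) =
        (\<integral>\<^sup>+z. ennreal ((u (fst z) + \<sigma> * u (?N z))\<^sup>2) \<partial>?Q)"
        by (subst P.nn_integral_fst[symmetric]) auto
      also have "\<dots> = ennreal (\<integral>z. (u (fst z) + \<sigma> * u (?N z))\<^sup>2 \<partial>?Q)"
      proof (rule nn_integral_eq_integral)
        show "integrable ?Q (\<lambda>z. (u (fst z) + \<sigma> * u (?N z))\<^sup>2)"
          unfolding e[OF that] using i1 i2 i3 by auto
      qed simp
      also have "(\<integral>z. (u (fst z) + \<sigma> * u (?N z))\<^sup>2 \<partial>?Q) = 2 * U + 2 * \<sigma> * b u u"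
        unfolding e[OF that] using i1 i2 i3 int_fst[of "\<lambda>x. (u x)\<^sup>2"] int_N[of "\<lambda>x. (u x)\<^sup>2"]
        by (simp add: b_def U_def)
      finally show ?thesis .
    qed
    \<comment> \<open>Since \<open>ennreal\<close> sends negative reals to 0, an inequality between
      \<open>ennreal\<close> values can be read in the reals only when the right side is known to be
      nonnegative.\<close>
    have norm_sq: "0 \<le> 2 * U + 2 * \<sigma> * b u u" if "\<sigma>\<^sup>2 = 1" for \<sigma>
    proof -
      have "0 \<le> (\<integral>z. (u (fst z) + \<sigma> * u (?N z))\<^sup>2 \<partial>?Q)" by simp
      also have "\<dots> = 2 * U + 2 * \<sigma> * b u u"
        unfolding e[OF that] using i1 i2 i3 int_fst[of "\<lambda>x. (u x)\<^sup>2"] int_N[of "\<lambda>x. (u x)\<^sup>2"]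
        by (simp add: b_def U_def)
      finally show ?thesis .
    qed
    have "ennreal (2 * \<beta> * U) \<le> ennreal (2 * U + 2 * b u u)"
      using plus[OF u] expand[of 1] U \<beta> by (simp add: ennreal_mult)
    then have "2 * \<beta> * U \<le> 2 * U + 2 * b u u"
      using norm_sq[of 1] by (subst (asm) ennreal_le_iff) simp_all
    moreover have "ennreal (2 * \<beta> * U) \<le> ennreal (2 * U - 2 * b u u)"
      using diff[OF u] expand[of "-1"] U \<beta> by (simp add: ennreal_mult)
    then have "2 * \<beta> * U \<le> 2 * U - 2 * b u u"
      using norm_sq[of "-1"] by (subst (asm) ennreal_le_iff) simp_all
    ultimately
    show "b u u \<le> c * (\<integral>x. (u x)\<^sup>2 \<partial>M)" "- b u u \<le> c * (\<integral>x. (u x)\<^sup>2 \<partial>M)"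
      unfolding U_def[symmetric] c_def by (simp_all add: algebra_simps)
  qed
  have "L2_norm M (kernel_op K f) \<le> c * L2_norm M f" if f: "f \<in> L2_0 M" for f
  proof -
    define h where "h = kernel_op K f"
    have h: "h \<in> L2_0 M" using kernel_L2_0[OF f] by (simp add: h_def)
    have L: "f \<in> L2 M" "h \<in> L2 M" and zero: "(\<integral>x. f x \<partial>M) = 0" "(\<integral>x. h x \<partial>M) = 0"
      using f h by (auto simp: L2_0_def)
    have sq: "integrable M (\<lambda>x. (f x)\<^sup>2)" "integrable M (\<lambda>x. (h x)\<^sup>2)" and fh: "integrable M (\<lambda>x. f x * h x)"
      using L L2_mult_integrable[OF L] by (auto simp: L2_def)
    define A B where "A = (\<integral>x. (f x)\<^sup>2 \<partial>M)" and "B = (\<integral>x. (h x)\<^sup>2 \<partial>M)"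
    have AB: "A \<ge> 0" "B \<ge> 0" by (auto simp: A_def B_def)
    have bhf: "b h f = B"
      using pairing[OF L] by (simp add: B_def h_def power2_eq_square)
    have BA: "B \<le> A"
      using kernel_sq[of f] sq AB L by (simp add: nn_integral_eq_integral A_def B_def h_def[symmetric] L2_def)
    \<comment> \<open>The form at t f + h minus the form at t f - h is 4 t b(f, h) = 4 t B, because
      h is the image of f; the squared norms of the two functions add up to 2 (t^2 A + B).\<close>
    have polar: "2 * t * B \<le> c * (t\<^sup>2 * A + B)" for t
    proof -
      define u where "u \<sigma> = (\<lambda>x. t * f x + \<sigma> * h x)" for \<sigma>
      have u: "u \<sigma> \<in> L2_0 M" for \<sigma>
        using L2_lincomb[OF L, of t \<sigma>] L zero M.L2_integrable[OF L(1)] M.L2_integrable[OF L(2)]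
        by (simp add: L2_0_def u_def)
      have nrm: "(\<integral>x. (u \<sigma> x)\<^sup>2 \<partial>M) = t\<^sup>2 * A + B + 2 * t * \<sigma> * (\<integral>x. f x * h x \<partial>M)" if "\<sigma>\<^sup>2 = 1" for \<sigma>
      proof -
        have "(u \<sigma> x)\<^sup>2 = t\<^sup>2 * (f x)\<^sup>2 + (h x)\<^sup>2 + 2 * t * \<sigma> * (f x * h x)" for x
          using that by (simp add: u_def power2_sum power_mult_distrib)
        then show ?thesis using sq fh by (simp add: A_def B_def)
      qed
      have bu: "b (u \<sigma>) (u \<sigma>) = t\<^sup>2 * b f f + b h h + 2 * t * \<sigma> * B" if "\<sigma>\<^sup>2 = 1" for \<sigma>
      proof -
        have "u \<sigma> (fst z) * u \<sigma> (?N z) = t\<^sup>2 * (f (fst z) * f (?N z)) + h (fst z) * h (?N z)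
          + t * \<sigma> * (f (fst z) * h (?N z)) + t * \<sigma> * (h (fst z) * f (?N z))" for z
        proof -
          have "u \<sigma> (fst z) * u \<sigma> (?N z) = t\<^sup>2 * (f (fst z) * f (?N z)) + \<sigma>\<^sup>2 * (h (fst z) * h (?N z))
            + t * \<sigma> * (f (fst z) * h (?N z)) + t * \<sigma> * (h (fst z) * f (?N z))"
            by (simp add: u_def power2_eq_square algebra_simps)
          then show ?thesis using that by simp
        qed
        then have "b (u \<sigma>) (u \<sigma>) = t\<^sup>2 * b f f + b h h + t * \<sigma> * b f h + t * \<sigma> * b h f"
          using b_int[OF L(1) L(1)] b_int[OF L(2) L(2)] b_int[OF L(1) L(2)] b_int[OF L(2) L(1)]
          unfolding b_def by simp
        then show ?thesis using b_sym[OF L] bhf by simp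
      qed
      have "b (u 1) (u 1) - b (u (-1)) (u (-1)) \<le> c * (\<integral>x. (u 1 x)\<^sup>2 \<partial>M) + c * (\<integral>x. (u (-1) x)\<^sup>2 \<partial>M)"
        using quad(1)[OF u[of 1]] quad(2)[OF u[of "-1"]] by linarith
      then show ?thesis
        by (simp add: bu nrm algebra_simps)
    qed
    have "sqrt B \<le> c * sqrt A"
    proof (cases "B = 0")
      case True
      then show ?thesis using AB \<beta> by (simp add: c_def)
    next
      case False
      \<comment> \<open>The contraction estimate \<open>BA\<close> keeps A positive, so that t below
        is defined properly.\<close>
      then have pos: "B > 0" "A > 0" using AB BA by auto
      \<comment> \<open>This choice balances the two terms: t^2 A = B.\<close>
      define t where "t = sqrt B / sqrt A"
      have "t\<^sup>2 * A = B" using pos by (simp add: t_def power_divide)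
      with polar[of t] have "2 * t * B \<le> c * (2 * B)" by simp
      then have "t \<le> c" using pos by (simp add: mult.assoc)
      then show ?thesis using pos by (simp add: t_def divide_le_eq)
    qed
    then show ?thesis
      by (simp add: L2_norm_def A_def B_def h_def)
  qed
  then show ?thesis
    unfolding L2_0_opnorm_def using kernel_L2_0 \<beta>
    by (intro Inf_lower) (auto simp: c_def)
qed

subsection \<open>Metropolis--Hastings chains\<close>

text \<open>Rejections only add nonnegative terms to both quadratic forms, and accepted moves keep a
  weight of at least exp (- 2 B). Passing from M to the Gibbs measure costs exp (2 B) in each
  variable: twice for differences of independent copies, once for the second moment. This explains
  the exponents 6 B and 4 B. The factor 2 / 9 is half of 4 / 9, since \<beta> enters the forms as 2
  \<beta>.\<close>

lemma metropolis_hastings_opnorm: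
  fixes M :: "'b measure" and P :: "'w measure" and P' :: "'v measure" and \<Psi> :: "'b \<Rightarrow> real"
  defines "\<alpha> \<equiv> \<lambda>x y. min 1 (exp (\<Psi> x - \<Psi> y))"
  assumes prob: "prob_space M" "prob_space P" "prob_space P'"
    and \<psi> [measurable]: "case_prod \<psi> \<in> M \<Otimes>\<^sub>M P \<rightarrow>\<^sub>M M"
    and N: "case_prod N \<in> M \<Otimes>\<^sub>M P' \<rightarrow>\<^sub>M M"
    and K: "\<And>x. x \<in> space M \<Longrightarrow> K x = distr P' M (N x)"
    and step: "\<And>x F. x \<in> space M \<Longrightarrow> F \<in> borel_measurable M \<Longrightarrow>
      (\<integral>\<^sup>+\<omega>. F (N x \<omega>) \<partial>P') =
      (\<integral>\<^sup>+\<omega>. ennreal (\<alpha> x (\<psi> x \<omega>)) * F (\<psi> x \<omega>) + ennreal (1 - \<alpha> x (\<psi> x \<omega>)) * F x \<partial>P)"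
    and reversible: "\<And>F. case_prod F \<in> borel_measurable (M \<Otimes>\<^sub>M M) \<Longrightarrow>
      (\<integral>\<^sup>+x. \<integral>\<^sup>+\<omega>. F x (\<psi> x \<omega>) \<partial>P \<partial>M) = (\<integral>\<^sup>+x. \<integral>\<^sup>+\<omega>. F (\<psi> x \<omega>) x \<partial>P \<partial>M)"
    and C: "C > 0"
    and diff: "\<And>f. f \<in> borel_measurable M \<Longrightarrow> (\<integral>\<^sup>+x. \<integral>\<^sup>+y. ennreal ((f x - f y)\<^sup>2) \<partial>M \<partial>M) \<le>
      ennreal C * (\<integral>\<^sup>+x. \<integral>\<^sup>+\<omega>. ennreal ((f x - f (\<psi> x \<omega>))\<^sup>2) \<partial>P \<partial>M)"
    and plus: "\<And>f. f \<in> borel_measurable M \<Longrightarrow> 4 * (\<integral>\<^sup>+x. ennreal ((f x)\<^sup>2) \<partial>M) \<le>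
      9 * (\<integral>\<^sup>+x. \<integral>\<^sup>+\<omega>. ennreal ((f x + f (\<psi> x \<omega>))\<^sup>2) \<partial>P \<partial>M)"
    and \<Psi> [measurable]: "\<Psi> \<in> borel_measurable M" and B: "\<And>x. x \<in> space M \<Longrightarrow> \<bar>\<Psi> x\<bar> \<le> B"
  shows "L2_0_opnorm (gibbs_measure M \<Psi>) K \<le> ereal (1 - min (exp (- 6 * B) / C) (2 / 9 * exp (- 4 * B)))"
proof -
  interpret M: prob_space M by fact
  interpret P: prob_space P by fact
  interpret P': prob_space P' by fact
  have B0: "B \<ge> 0"
    using M.not_empty B by fastforce
  define Z where "Z = (\<integral>x. exp (- \<Psi> x) \<partial>M)"
  have exp_bounds: "exp (- B) \<le> exp (- \<Psi> x)" "exp (- \<Psi> x) \<le> exp B" if "x \<in> space M" for x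
    using B[OF that] by auto
  have int: "integrable M (\<lambda>x. exp (- \<Psi> x))"
    by (rule M.integrable_const_bound[of _ "exp B"]) (use exp_bounds in auto)
  have Z: "exp (- B) \<le> Z" "Z \<le> exp B"
    unfolding Z_def using int exp_bounds by (auto intro!: M.integral_ge_const M.integral_le_const AE_I2)
  have Z0: "Z > 0" using Z(1) by (metis exp_gt_zero less_le_trans)
  define g where "g x = exp (- \<Psi> x) / Z" for x
  have [measurable]: "g \<in> borel_measurable M" unfolding g_def by measurable
  have g0: "g x > 0" for x using Z0 by (simp add: g_def)
  \<comment> \<open>The unnormalised density and its normaliser each contribute a factor of at most
    exp B, in either direction.\<close>
  have g: "exp (- 2 * B) \<le> g x" "g x \<le> exp (2 * B)" if "x \<in> space M" for x
  proof -
    have "exp (- 2 * B) = exp (- B) / exp B" "exp (2 * B) = exp B / exp (- B)"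
      by (simp_all add: exp_diff[symmetric])
    then show "exp (- 2 * B) \<le> g x" "g x \<le> exp (2 * B)"
      unfolding g_def using exp_bounds[OF that] Z Z0 by (auto intro!: frac_le)
  qed
  define \<mu> where "\<mu> = gibbs_measure M \<Psi>"
  have \<mu>: "\<mu> = density M (\<lambda>x. ennreal (g x))"
    by (simp add: \<mu>_def gibbs_measure_def g_def Z_def)
  have sets_\<mu> [simp, measurable_cong]: "sets \<mu> = sets M" by (simp add: \<mu>)
  have space_\<mu> [simp]: "space \<mu> = space M" by (simp add: \<mu>)
  have nn_\<mu>: "(\<integral>\<^sup>+x. F x \<partial>\<mu>) = (\<integral>\<^sup>+x. ennreal (g x) * F x \<partial>M)" if "F \<in> borel_measurable M" for F
    unfolding \<mu> using that by (intro nn_integral_density) auto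
  have "(\<integral>\<^sup>+x. ennreal (g x) \<partial>M) = 1"
  proof -
    have "(\<integral>\<^sup>+x. ennreal (g x) \<partial>M) = ennreal (\<integral>x. g x \<partial>M)"
      using int less_imp_le[OF g0] by (intro nn_integral_eq_integral) (auto simp: g_def)
    also have "(\<integral>x. g x \<partial>M) = 1" using Z0 by (simp add: g_def Z_def)
    finally show ?thesis by simp
  qed
  then have "prob_space \<mu>"
    using nn_\<mu>[of "\<lambda>_. 1"] by (intro prob_spaceI) simp
  interpret \<mu>: prob_space \<mu> by fact
  \<comment> \<open>The target density at x times the acceptance probability of y. Its symmetry is
    detailed balance.\<close>
  define r where "r x y = min (g x) (g y)" for x y
  have r_sym: "r x y = r y x" for x y by (simp add: r_def min.commute)
  have r0: "r x y \<ge> 0" and r_le: "r x y \<le> g x" for x y using g0[of x] g0[of y] by (auto simp: r_def)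
  have [measurable]: "case_prod r \<in> borel_measurable (M \<Otimes>\<^sub>M M)" unfolding r_def by measurable
  have \<alpha>: "0 \<le> \<alpha> x y" "\<alpha> x y \<le> 1" "g x * \<alpha> x y = r x y" for x y
  proof -
    have "g x * exp (\<Psi> x - \<Psi> y) = g y"
      using Z0 by (simp add: g_def exp_diff exp_minus field_simps)
    then show "g x * \<alpha> x y = r x y"
      using g0[of x] by (simp add: \<alpha>_def r_def min_mult_distrib_left)
  qed (auto simp: \<alpha>_def)
  \<comment> \<open>Accepted and rejected moves, both integrated against M. The first part is
    symmetric in the arguments of F because r and the proposal are; the second sees only F x x,
    which an exchange of arguments leaves unchanged.\<close>
  define off where "off F = (\<integral>\<^sup>+x. \<integral>\<^sup>+\<omega>. ennreal (r x (\<psi> x \<omega>)) * F x (\<psi> x \<omega>) \<partial>P \<partial>M)"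
    for F :: "'b \<Rightarrow> 'b \<Rightarrow> ennreal"
  define diag where "diag F = (\<integral>\<^sup>+x. \<integral>\<^sup>+\<omega>. ennreal (g x - r x (\<psi> x \<omega>)) * F x x \<partial>P \<partial>M)"
    for F :: "'b \<Rightarrow> 'b \<Rightarrow> ennreal"
  have split: "(\<integral>\<^sup>+x. \<integral>\<^sup>+\<omega>. F x (N x \<omega>) \<partial>P' \<partial>\<mu>) = off F + diag F"
    if [measurable]: "case_prod F \<in> borel_measurable (M \<Otimes>\<^sub>M M)" for F
  proof -
    note [measurable] = N
    have "(\<integral>\<^sup>+x. \<integral>\<^sup>+\<omega>. F x (N x \<omega>) \<partial>P' \<partial>\<mu>) = (\<integral>\<^sup>+x. ennreal (g x) * (\<integral>\<^sup>+\<omega>. F x (N x \<omega>) \<partial>P') \<partial>M)"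
      by (rule nn_\<mu>) measurable
    also have "\<dots> = (\<integral>\<^sup>+x. (\<integral>\<^sup>+\<omega>. ennreal (r x (\<psi> x \<omega>)) * F x (\<psi> x \<omega>) \<partial>P) +
      (\<integral>\<^sup>+\<omega>. ennreal (g x - r x (\<psi> x \<omega>)) * F x x \<partial>P) \<partial>M)"
    proof (rule nn_integral_cong)
      fix x assume x [measurable]: "x \<in> space M"
      have e: "ennreal (g x) * (ennreal (\<alpha> x y) * a + ennreal (1 - \<alpha> x y) * b) =
        ennreal (r x y) * a + ennreal (g x - r x y) * b" for y a b
      proof -
        have "ennreal (g x) * ennreal (\<alpha> x y) = ennreal (r x y)"
          using \<alpha>[of x y] g0[of x] by (simp add: ennreal_mult[symmetric])
        moreover have "ennreal (g x) * ennreal (1 - \<alpha> x y) = ennreal (g x - r x y)"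
          using \<alpha>[of x y] g0[of x] by (simp add: ennreal_mult[symmetric] right_diff_distrib)
        ultimately show ?thesis by (simp add: distrib_left mult.assoc[symmetric])
      qed
      have [measurable]: "\<alpha> x \<in> borel_measurable M" unfolding \<alpha>_def by measurable
      have "ennreal (g x) * (\<integral>\<^sup>+\<omega>. F x (N x \<omega>) \<partial>P') =
        (\<integral>\<^sup>+\<omega>. ennreal (g x) * (ennreal (\<alpha> x (\<psi> x \<omega>)) * F x (\<psi> x \<omega>) + ennreal (1 - \<alpha> x (\<psi> x \<omega>)) * F x x) \<partial>P)"
        by (subst step[OF x]) (measurable, rule nn_integral_cmult[symmetric], measurable)
      also have "\<dots> = (\<integral>\<^sup>+\<omega>. ennreal (r x (\<psi> x \<omega>)) * F x (\<psi> x \<omega>) \<partial>P) +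
          (\<integral>\<^sup>+\<omega>. ennreal (g x - r x (\<psi> x \<omega>)) * F x x \<partial>P)"
        unfolding e by (rule nn_integral_add) measurable
      finally show "ennreal (g x) * (\<integral>\<^sup>+\<omega>. F x (N x \<omega>) \<partial>P') = \<dots>" .
    qed
    also have "\<dots> = off F + diag F"
      unfolding off_def diag_def by (rule nn_integral_add) measurable
    finally show ?thesis .
  qed
  have reversible_\<mu>: "(\<integral>\<^sup>+x. \<integral>\<^sup>+\<omega>. F x (N x \<omega>) \<partial>P' \<partial>\<mu>) = (\<integral>\<^sup>+x. \<integral>\<^sup>+\<omega>. F (N x \<omega>) x \<partial>P' \<partial>\<mu>)"
    if F: "case_prod F \<in> borel_measurable (\<mu> \<Otimes>\<^sub>M \<mu>)" for F
  proof -
    have [measurable]: "case_prod F \<in> borel_measurable (M \<Otimes>\<^sub>M M)"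
      using F by (simp cong: sets_pair_measure_cong measurable_cong_sets)
    have "off F = off (\<lambda>x y. F y x)"
      unfolding off_def using reversible[of "\<lambda>x y. ennreal (r x y) * F x y"] by (simp add: r_sym)
    moreover have "case_prod (\<lambda>x y. F y x) \<in> borel_measurable (M \<Otimes>\<^sub>M M)" by measurable
    ultimately show ?thesis
      using split[of F] split[of "\<lambda>x y. F y x"] by (simp add: diag_def)
  qed
  have off_ge: "ennreal (exp (- 2 * B)) * (\<integral>\<^sup>+x. \<integral>\<^sup>+\<omega>. F x (\<psi> x \<omega>) \<partial>P \<partial>M) \<le>
      (\<integral>\<^sup>+x. \<integral>\<^sup>+\<omega>. F x (N x \<omega>) \<partial>P' \<partial>\<mu>)"
    if F [measurable]: "case_prod F \<in> borel_measurable (M \<Otimes>\<^sub>M M)" for F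
  proof -
    have sp: "\<psi> x \<omega> \<in> space M" if "x \<in> space M" "\<omega> \<in> space P" for x \<omega>
      using measurable_space[OF \<psi>, of "(x, \<omega>)"] that by (simp add: space_pair_measure)
    have "ennreal (exp (- 2 * B)) * (\<integral>\<^sup>+x. \<integral>\<^sup>+\<omega>. F x (\<psi> x \<omega>) \<partial>P \<partial>M) =
      (\<integral>\<^sup>+x. ennreal (exp (- 2 * B)) * (\<integral>\<^sup>+\<omega>. F x (\<psi> x \<omega>) \<partial>P) \<partial>M)"
      by (rule nn_integral_cmult[symmetric]) measurable
    also have "\<dots> = (\<integral>\<^sup>+x. \<integral>\<^sup>+\<omega>. ennreal (exp (- 2 * B)) * F x (\<psi> x \<omega>) \<partial>P \<partial>M)"
      by (intro nn_integral_cong nn_integral_cmult[symmetric]) measurable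
    also have "\<dots> \<le> off F"
      unfolding off_def using g sp
      by (intro nn_integral_mono mult_right_mono ennreal_leI) (auto simp: r_def)
    also have "\<dots> \<le> (\<integral>\<^sup>+x. \<integral>\<^sup>+\<omega>. F x (N x \<omega>) \<partial>P' \<partial>\<mu>)"
      unfolding split[OF F] by (rule add_increasing2) auto
    finally show ?thesis .
  qed
  have \<mu>_le: "(\<integral>\<^sup>+x. F x \<partial>\<mu>) \<le> ennreal (exp (2 * B)) * (\<integral>\<^sup>+x. F x \<partial>M)"
    if [measurable]: "F \<in> borel_measurable M" for F
  proof -
    have "(\<integral>\<^sup>+x. F x \<partial>\<mu>) \<le> (\<integral>\<^sup>+x. ennreal (exp (2 * B)) * F x \<partial>M)"
      unfolding nn_\<mu>[OF that] using g by (intro nn_integral_mono mult_right_mono ennreal_leI) auto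
    also have "\<dots> = ennreal (exp (2 * B)) * (\<integral>\<^sup>+x. F x \<partial>M)"
      by (rule nn_integral_cmult) measurable
    finally show ?thesis .
  qed
  define \<beta> where "\<beta> = min (exp (- 6 * B) / C) (2 / 9 * exp (- 4 * B))"
  have \<beta>_le: "\<beta> \<le> exp (- 6 * B) / C" "\<beta> \<le> 2 / 9 * exp (- 4 * B)"
    unfolding \<beta>_def by (rule min.cobounded1, rule min.cobounded2)
  have \<beta>: "0 \<le> \<beta>" "\<beta> \<le> 1"
  proof -
    show "0 \<le> \<beta>" using C by (simp add: \<beta>_def)
    have "\<beta> \<le> 2 / 9 * exp (- 4 * B)" by (rule \<beta>_le)
    also have "\<dots> \<le> 2 / 9 * 1" using B0 by (intro mult_left_mono) auto
    finally show "\<beta> \<le> 1" by simp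
  qed
  have ennreal_mult4: "ennreal a * (ennreal b * (ennreal c * (ennreal e * J))) = ennreal (a * b * c * e) * J"
    if "a \<ge> 0" "b \<ge> 0" "c \<ge> 0" "e \<ge> 0" for a b c e J
    using that by (simp add: ennreal_mult mult.assoc)
  have "L2_0_opnorm \<mu> K \<le> ereal (1 - \<beta>)"
  proof (rule L2_0_opnorm_le_of_quadratic_form[where P=P' and N=N])
    show "case_prod N \<in> \<mu> \<Otimes>\<^sub>M P' \<rightarrow>\<^sub>M \<mu>"
      using N by (simp cong: sets_pair_measure_cong measurable_cong_sets)
    show "K x = distr P' \<mu> (N x)" if "x \<in> space \<mu>" for x
      using K that by (simp cong: distr_cong)
  next
    fix f assume f: "f \<in> L2_0 \<mu>"
    then have [measurable]: "f \<in> borel_measurable M"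
      by (simp add: L2_0_def L2_def cong: measurable_cong_sets)
    let ?I = "\<integral>\<^sup>+x. \<integral>\<^sup>+\<omega>. ennreal ((f x - f (N x \<omega>))\<^sup>2) \<partial>P' \<partial>\<mu>"
    let ?J = "\<integral>\<^sup>+x. \<integral>\<^sup>+\<omega>. ennreal ((f x - f (\<psi> x \<omega>))\<^sup>2) \<partial>P \<partial>M"
    have "2 * (\<integral>\<^sup>+x. ennreal ((f x)\<^sup>2) \<partial>\<mu>) = (\<integral>\<^sup>+x. \<integral>\<^sup>+y. ennreal ((f x - f y)\<^sup>2) \<partial>\<mu> \<partial>\<mu>)"
      by (rule \<mu>.nn_integral_sq_diff[OF f, symmetric])
    also have "\<dots> \<le> (\<integral>\<^sup>+x. ennreal (exp (2 * B)) * (\<integral>\<^sup>+y. ennreal ((f x - f y)\<^sup>2) \<partial>M) \<partial>\<mu>)"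
      by (intro nn_integral_mono \<mu>_le) measurable
    also have "\<dots> \<le> ennreal (exp (2 * B)) * (\<integral>\<^sup>+x. ennreal (exp (2 * B)) * (\<integral>\<^sup>+y. ennreal ((f x - f y)\<^sup>2) \<partial>M) \<partial>M)"
      by (rule \<mu>_le) measurable
    also have "(\<integral>\<^sup>+x. ennreal (exp (2 * B)) * (\<integral>\<^sup>+y. ennreal ((f x - f y)\<^sup>2) \<partial>M) \<partial>M) =
      ennreal (exp (2 * B)) * (\<integral>\<^sup>+x. \<integral>\<^sup>+y. ennreal ((f x - f y)\<^sup>2) \<partial>M \<partial>M)"
      by (rule nn_integral_cmult) measurable
    also have "ennreal (exp (2 * B)) * (ennreal (exp (2 * B)) * (\<integral>\<^sup>+x. \<integral>\<^sup>+y. ennreal ((f x - f y)\<^sup>2) \<partial>M \<partial>M)) \<le>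
      ennreal (exp (2 * B)) * (ennreal (exp (2 * B)) * (ennreal C * ?J))"
      by (intro mult_left_mono diff) auto
    finally have le: "2 * (\<integral>\<^sup>+x. ennreal ((f x)\<^sup>2) \<partial>\<mu>) \<le>
      ennreal (exp (2 * B)) * (ennreal (exp (2 * B)) * (ennreal C * ?J))" .
    have "ennreal \<beta> * (2 * (\<integral>\<^sup>+x. ennreal ((f x)\<^sup>2) \<partial>\<mu>)) \<le>
      ennreal (exp (- 6 * B) / C) * (ennreal (exp (2 * B)) * (ennreal (exp (2 * B)) * (ennreal C * ?J)))"
      by (rule mult_mono[OF ennreal_leI[OF \<beta>_le(1)] le]) auto
    also have "\<dots> = ennreal (exp (- 6 * B) / C * exp (2 * B) * exp (2 * B) * C) * ?J"
      using C by (intro ennreal_mult4) auto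
    also have "exp (- 6 * B) / C * exp (2 * B) * exp (2 * B) * C = exp (- 2 * B)"
      using C by (simp add: exp_add[symmetric])
    also have "ennreal (exp (- 2 * B)) * ?J \<le> ?I"
      by (rule off_ge) measurable
    finally show "ennreal (2 * \<beta>) * (\<integral>\<^sup>+x. ennreal ((f x)\<^sup>2) \<partial>\<mu>) \<le> ?I"
      using \<beta> by (simp add: ennreal_mult mult_ac)
  next
    fix f assume f: "f \<in> L2_0 \<mu>"
    then have [measurable]: "f \<in> borel_measurable M"
      by (simp add: L2_0_def L2_def cong: measurable_cong_sets)
    let ?I = "\<integral>\<^sup>+x. \<integral>\<^sup>+\<omega>. ennreal ((f x + f (N x \<omega>))\<^sup>2) \<partial>P' \<partial>\<mu>"
    let ?J = "\<integral>\<^sup>+x. \<integral>\<^sup>+\<omega>. ennreal ((f x + f (\<psi> x \<omega>))\<^sup>2) \<partial>P \<partial>M"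
    have "4 * (\<integral>\<^sup>+x. ennreal ((f x)\<^sup>2) \<partial>\<mu>) \<le> 4 * (ennreal (exp (2 * B)) * (\<integral>\<^sup>+x. ennreal ((f x)\<^sup>2) \<partial>M))"
      by (intro mult_left_mono \<mu>_le) auto
    also have "\<dots> = ennreal (exp (2 * B)) * (4 * (\<integral>\<^sup>+x. ennreal ((f x)\<^sup>2) \<partial>M))"
      by (simp add: mult_ac)
    also have "\<dots> \<le> ennreal (exp (2 * B)) * (9 * ?J)"
      by (intro mult_left_mono plus) auto
    finally have le: "4 * (\<integral>\<^sup>+x. ennreal ((f x)\<^sup>2) \<partial>\<mu>) \<le> ennreal (exp (2 * B)) * (9 * ?J)" .
    have "ennreal (1 / 9 * exp (- 4 * B)) * (4 * (\<integral>\<^sup>+x. ennreal ((f x)\<^sup>2) \<partial>\<mu>)) \<le>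
      ennreal (1 / 9 * exp (- 4 * B)) * (ennreal (exp (2 * B)) * (ennreal 9 * ?J))"
      using mult_left_mono[OF le] by simp
    also have "\<dots> = ennreal (1 / 9 * exp (- 4 * B) * exp (2 * B) * 9) * ?J"
      using ennreal_mult4[of "1 / 9 * exp (- 4 * B)" "exp (2 * B)" 9 1 ?J] by simp
    also have "1 / 9 * exp (- 4 * B) * exp (2 * B) * 9 = exp (- 2 * B)"
      by (simp add: exp_add[symmetric])
    also have "ennreal (exp (- 2 * B)) * ?J \<le> ?I"
      by (rule off_ge) measurable
    finally have "ennreal (1 / 9 * exp (- 4 * B)) * (4 * (\<integral>\<^sup>+x. ennreal ((f x)\<^sup>2) \<partial>\<mu>)) \<le> ?I" .
    moreover have "ennreal (1 / 9 * exp (- 4 * B)) * (4 * (\<integral>\<^sup>+x. ennreal ((f x)\<^sup>2) \<partial>\<mu>)) =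
      ennreal (2 * (2 / 9 * exp (- 4 * B))) * (\<integral>\<^sup>+x. ennreal ((f x)\<^sup>2) \<partial>\<mu>)"
    proof -
      have "ennreal (2 * (2 / 9 * exp (- 4 * B))) = ennreal (1 / 9 * exp (- 4 * B)) * ennreal 4"
        by (subst ennreal_mult[symmetric]) auto
      then show ?thesis by (simp add: mult.assoc)
    qed
    ultimately have "ennreal (2 * (2 / 9 * exp (- 4 * B))) * (\<integral>\<^sup>+x. ennreal ((f x)\<^sup>2) \<partial>\<mu>) \<le> ?I"
      by simp
    moreover have "ennreal (2 * \<beta>) \<le> ennreal (2 * (2 / 9 * exp (- 4 * B)))"
      by (intro ennreal_leI mult_left_mono \<beta>_le) auto
    ultimately show "ennreal (2 * \<beta>) * (\<integral>\<^sup>+x. ennreal ((f x)\<^sup>2) \<partial>\<mu>) \<le> ?I"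
      by (meson mult_right_mono order_trans zero_le)
  qed (fact | rule reversible_\<mu>)+
  then show ?thesis
    unfolding \<mu>_def \<beta>_def .
qed

subsection \<open>The reprojected chain\<close>

lemma measurable_usphere_borel_iff:
  "f \<in> N \<rightarrow>\<^sub>M usphere_borel d \<longleftrightarrow> f \<in> N \<rightarrow>\<^sub>M euclidean_borel d \<and> (\<forall>x\<in>space N. f x \<in> usphere d)"
  unfolding usphere_borel_def by (auto simp: measurable_restrict_space2_iff)

lemma measurable_usphere_borelD [measurable_dest]:
  "f \<in> N \<rightarrow>\<^sub>M usphere_borel d \<Longrightarrow> f \<in> N \<rightarrow>\<^sub>M euclidean_borel d"
  by (simp add: measurable_usphere_borel_iff)

lemma space_usphere_borel [simp]: "space (usphere_borel d) = usphere d"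
  by (auto simp: usphere_borel_def space_restrict_space usphere_def)

lemma L2_set_lincomb_scale: "L2_set (lincomb d c x 0 x) {..<d} = \<bar>c\<bar> * L2_set x {..<d}"
proof -
  have "L2_set (lincomb d c x 0 x) {..<d} = L2_set (\<lambda>j. \<bar>c\<bar> * \<bar>x j\<bar>) {..<d}"
    unfolding L2_set_def by (intro arg_cong[where f=sqrt] sum.cong) (auto simp: power_mult_distrib)
  also have "\<dots> = \<bar>c\<bar> * L2_set (\<lambda>j. \<bar>x j\<bar>) {..<d}"
    by (rule L2_set_right_distrib[symmetric]) simp
  also have "L2_set (\<lambda>j. \<bar>x j\<bar>) {..<d} = L2_set x {..<d}"
    unfolding L2_set_def by simp
  finally show ?thesis .
qed

lemma radial_projection_eq:
  "L2_set x {..<d} \<noteq> 0 \<Longrightarrow> radial_projection d p x = lincomb d (1 / L2_set x {..<d}) x 0 x"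
  by (auto simp: radial_projection_def lincomb_def)

lemma radial_projection_in_usphere:
  assumes "p \<in> usphere d"
  shows "radial_projection d p x \<in> usphere d"
proof (cases "L2_set x {..<d} = 0")
  case True
  then show ?thesis using assms by (simp add: radial_projection_def)
next
  case False
  then have "L2_set (radial_projection d p x) {..<d} = 1"
    by (simp add: radial_projection_eq L2_set_lincomb_scale)
  then show ?thesis
    using False by (simp add: usphere_def radial_projection_eq)
qed

lemma radial_projection_scale:
  assumes "c > 0"
  shows "radial_projection d p (lincomb d c x 0 x) = radial_projection d p x"
proof (cases "L2_set x {..<d} = 0")
  case True
  then show ?thesis by (simp add: radial_projection_def L2_set_lincomb_scale)
next
  case False
  then show ?thesis
    using assms by (intro euclidean_borel_eqI[of _ d]) (simp_all add: radial_projection_eq L2_set_lincomb_scale)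
qed

lemma measurable_radial_projection [measurable (raw)]:
  assumes p: "p \<in> usphere d" and [measurable]: "f \<in> N \<rightarrow>\<^sub>M euclidean_borel d"
  shows "(\<lambda>x. radial_projection d p (f x)) \<in> N \<rightarrow>\<^sub>M usphere_borel d"
proof -
  have [measurable]: "p \<in> space (euclidean_borel d)" using p by (simp add: usphere_def)
  have "(\<lambda>x. if L2_set (f x) {..<d} = 0 then p else lincomb d (1 / L2_set (f x) {..<d}) (f x) 0 (f x))
    \<in> N \<rightarrow>\<^sub>M euclidean_borel d"
    by measurable
  also have "(\<lambda>x. if L2_set (f x) {..<d} = 0 then p else lincomb d (1 / L2_set (f x) {..<d}) (f x) 0 (f x)) =
    (\<lambda>x. radial_projection d p (f x))"
    by (auto simp: fun_eq_iff radial_projection_eq) (simp add: radial_projection_def)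
  finally show ?thesis
    using radial_projection_in_usphere[OF p] by (simp add: measurable_usphere_borel_iff)
qed

lemma pcn_proposal_eq:
  "pcn_proposal d p s r w x = radial_projection d p (lincomb d (sqrt (1 - s\<^sup>2)) (lincomb d r x 0 x) s w)"
  unfolding pcn_proposal_def by (rule arg_cong[where f="radial_projection d p"]) (auto simp: lincomb_def)

lemma measurable_pcn_proposal [measurable (raw)]:
  assumes p: "p \<in> usphere d" and [measurable]: "r \<in> borel_measurable N" "w \<in> N \<rightarrow>\<^sub>M euclidean_borel d"
    "x \<in> N \<rightarrow>\<^sub>M euclidean_borel d"
  shows "(\<lambda>z. pcn_proposal d p s (r z) (w z) (x z)) \<in> N \<rightarrow>\<^sub>M usphere_borel d"
  unfolding pcn_proposal_eq by (rule measurable_radial_projection[OF p]) measurable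

lemma nn_integral_uniform_threshold:
  fixes F :: "'b \<Rightarrow> ennreal"
  assumes c: "0 \<le> c" "c \<le> 1"
  shows "(\<integral>\<^sup>+u. F (if u \<le> c then y else x) \<partial>uniform_measure lborel {0..1::real}) = ennreal c * F y + ennreal (1 - c) * F x"
proof -
  let ?U = "uniform_measure lborel {0..1::real}"
  have "(\<integral>\<^sup>+u. F (if u \<le> c then y else x) \<partial>?U) = (\<integral>\<^sup>+u. F y * indicator {..c} u + F x * indicator {c<..} u \<partial>?U)"
    by (intro nn_integral_cong) (auto simp: indicator_def)
  also have "\<dots> = F y * emeasure ?U {..c} + F x * emeasure ?U {c<..}"
    by (subst nn_integral_add) (auto simp: nn_integral_cmult_indicator)
  also have "emeasure ?U {..c} = ennreal c"
  proof -
    have "{0..1} \<inter> {..c} = {0..c}" using c by auto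
    then show ?thesis using c by (simp add: emeasure_uniform_measure divide_ennreal_def)
  qed
  also have "emeasure ?U {c<..} = ennreal (1 - c)"
  proof -
    have "{0..1} \<inter> {c<..} = {c<..1}" using c by auto
    then show ?thesis using c by (simp add: emeasure_uniform_measure divide_ennreal_def)
  qed
  finally show ?thesis by (simp add: mult.commute)
qed

section \<open>The chain as a random map with state-independent noise\<close>

locale reprojected_pcn = diag_gaussian +
  fixes p :: "nat \<Rightarrow> real" and s :: real
  assumes d: "d \<ge> 1" and p: "p \<in> usphere d" and s: "0 < s" "s \<le> 1"
begin

abbreviation "\<mu>0 \<equiv> ACG lam d p"
abbreviation "S \<equiv> usphere_borel d"
abbreviation "G \<equiv> gamma_distribution (d / 2) 1"
abbreviation "U \<equiv> uniform_measure lborel {0..1::real}"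

text \<open>Dividing a unit-rate Gamma variable by the rate lets the kernels of all states share one
  source of randomness.\<close>

definition proposal :: "(nat \<Rightarrow> real) \<Rightarrow> real \<times> (nat \<Rightarrow> real) \<Rightarrow> nat \<Rightarrow> real" where
  "proposal x = (\<lambda>(t, w). pcn_proposal d p s (sqrt (t / (inv_quadratic_form lam d x / 2))) w x)"

definition mh_step :: "((nat \<Rightarrow> real) \<Rightarrow> real) \<Rightarrow> (nat \<Rightarrow> real) \<Rightarrow> real \<times> (nat \<Rightarrow> real) \<times> real \<Rightarrow> nat \<Rightarrow> real" where
  "mh_step \<Psi> x = (\<lambda>(t, w, u). if u \<le> min 1 (exp (\<Psi> x - \<Psi> (proposal x (t, w)))) then proposal x (t, w) else x)"

text \<open>The step size s corresponds to the correlation \<open>sqrt (1 - s\<^sup>2)\<close>. The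
  last equation recovers s as the noise coefficient used in \<open>pcn\<close>; s > 0 is what keeps
  the correlation below 1.\<close>

lemma a_bounds: "0 \<le> sqrt (1 - s\<^sup>2)" "sqrt (1 - s\<^sup>2) < 1" "sqrt (1 - (sqrt (1 - s\<^sup>2))\<^sup>2) = s"
proof -
  have s2: "0 < s\<^sup>2" "s\<^sup>2 \<le> 1" using s by (auto simp: power_le_one)
  then show "0 \<le> sqrt (1 - s\<^sup>2)" "sqrt (1 - s\<^sup>2) < 1" by auto
  show "sqrt (1 - (sqrt (1 - s\<^sup>2))\<^sup>2) = s" using s s2 by simp
qed

lemma measurable_radial_projection_usphere [measurable (raw)]: "f \<in> N \<rightarrow>\<^sub>M E \<Longrightarrow> (\<lambda>x. radial_projection d p (f x)) \<in> N \<rightarrow>\<^sub>M S"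
  by (rule measurable_radial_projection[OF p])

lemma sets_ACG [simp, measurable_cong]: "sets \<mu>0 = sets S"
  by (simp add: ACG_def)

lemma space_ACG [simp]: "space \<mu>0 = usphere d"
  by (simp add: ACG_def)

lemma prob_space_ACG: "prob_space \<mu>0"
  unfolding ACG_def by (rule prob_space_distr) measurable

lemma nn_integral_ACG:
  assumes [measurable]: "F \<in> borel_measurable S"
  shows "(\<integral>\<^sup>+x. F x \<partial>\<mu>0) = (\<integral>\<^sup>+x. F (radial_projection d p x) \<partial>\<gamma>)"
  unfolding ACG_def by (rule nn_integral_distr) measurable

lemma prob_space_G: "prob_space G"
  using d by (intro prob_space_gamma_distribution) auto

lemma prob_space_U: "prob_space U"
  by (rule prob_space_uniform_measure) auto

lemma usphere_inv_quadratic_form_pos: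
  assumes "x \<in> usphere d"
  shows "inv_quadratic_form lam d x > 0"
proof -
  have "L2_set x {..<d} \<noteq> 0" using assms by (simp add: usphere_def)
  then obtain j where "j < d" "x j \<noteq> 0" by (auto simp: L2_set_eq_0_iff)
  then show ?thesis by (rule inv_quadratic_form_pos)
qed

lemma measurable_proposal [measurable]: "case_prod proposal \<in> S \<Otimes>\<^sub>M (G \<Otimes>\<^sub>M \<gamma>) \<rightarrow>\<^sub>M S"
  unfolding proposal_def case_prod_unfold by (rule measurable_pcn_proposal[OF p]) measurable

text \<open>The resampled vector x' depends on x only through its direction, so normalising x before
  drawing the radius does not alter it. Hence the proposal is the projection of a linear pCN move
  from x'. The second equation lets the current state be expressed through x' as well.\<close>

lemma proposal_radial_projection:
  assumes q: "inv_quadratic_form lam d x > 0" and t: "t > 0"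
  defines "x' \<equiv> lincomb d (sqrt (t / (inv_quadratic_form lam d x / 2))) x 0 x"
  shows "proposal (radial_projection d p x) (t, w) = radial_projection d p (lincomb d (sqrt (1 - s\<^sup>2)) x' s w)"
    and "radial_projection d p x' = radial_projection d p x"
proof -
  show "radial_projection d p x' = radial_projection d p x"
    unfolding x'_def using q t by (intro radial_projection_scale) simp
  define L where "L = L2_set x {..<d}"
  have "L \<noteq> 0"
  proof
    assume "L = 0"
    then have "\<forall>j<d. x j = 0" by (auto simp: L_def L2_set_eq_0_iff)
    then have "inv_quadratic_form lam d x = 0" by (simp add: inv_quadratic_form_def)
    then show False using q by simp
  qed
  then have L: "L > 0" using L2_set_nonneg[of x "{..<d}"] unfolding L_def by linarith
  have \<Pi>: "radial_projection d p x = lincomb d (1 / L) x 0 x"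
    using L by (simp add: radial_projection_eq L_def)
  define \<rho> where "\<rho> = sqrt (t / (inv_quadratic_form lam d x / 2))"
  \<comment> \<open>The quadratic form is homogeneous of degree 2, so at the unit vector the radius
    is L times larger, which undoes the division by L.\<close>
  have r: "sqrt (t / (inv_quadratic_form lam d (radial_projection d p x) / 2)) = L * \<rho>"
  proof -
    have "t / (inv_quadratic_form lam d (radial_projection d p x) / 2) = L\<^sup>2 * (t / (inv_quadratic_form lam d x / 2))"
      using L q by (simp add: \<Pi> inv_quadratic_form_scale power_divide field_simps)
    then show ?thesis
      using L unfolding \<rho>_def by (simp only: real_sqrt_mult real_sqrt_unique)
  qed
  have "lincomb d (L * \<rho>) (radial_projection d p x) 0 (radial_projection d p x) = x'"
    unfolding \<Pi> x'_def \<rho>_def[symmetric] using L by (intro euclidean_borel_eqI[of _ d]) auto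
  then show "proposal (radial_projection d p x) (t, w) = radial_projection d p (lincomb d (sqrt (1 - s\<^sup>2)) x' s w)"
    unfolding proposal_def pcn_proposal_eq prod.case r by simp
qed

text \<open>Pulled back to a Gaussian vector x, both the state and its proposal become functions of
  the resampled vector x', which is Gaussian again by \<open>gaussian_radial_resampling\<close>.
  Every question about the proposal on the sphere thus becomes one about the linear pCN
  pair.\<close>

lemma nn_integral_proposal:
  assumes [measurable]: "case_prod F \<in> borel_measurable (S \<Otimes>\<^sub>M S)"
  shows "(\<integral>\<^sup>+x. \<integral>\<^sup>+\<omega>. F x (proposal x \<omega>) \<partial>(G \<Otimes>\<^sub>M \<gamma>) \<partial>\<mu>0) =
    pcn (sqrt (1 - s\<^sup>2)) (\<lambda>x y. F (radial_projection d p x) (radial_projection d p y))"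
proof -
  interpret G: prob_space G by (rule prob_space_G)
  interpret G\<gamma>: pair_prob_space G \<gamma> ..
  let ?\<Pi> = "radial_projection d p" and ?q = "inv_quadratic_form lam d"
  \<comment> \<open>The expected value of F for one step from x', averaged over the noise w. It is
    applied at x' and not at x.\<close>
  define H where "H x = (\<integral>\<^sup>+w. F (?\<Pi> x) (?\<Pi> (lincomb d (sqrt (1 - s\<^sup>2)) x s w)) \<partial>\<gamma>)" for x
  have [measurable]: "H \<in> borel_measurable E"
    unfolding H_def by measurable
  have "(\<integral>\<^sup>+x. \<integral>\<^sup>+\<omega>. F x (proposal x \<omega>) \<partial>(G \<Otimes>\<^sub>M \<gamma>) \<partial>\<mu>0) = (\<integral>\<^sup>+x. \<integral>\<^sup>+\<omega>. F (?\<Pi> x) (proposal (?\<Pi> x) \<omega>) \<partial>(G \<Otimes>\<^sub>M \<gamma>) \<partial>\<gamma>)"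
    by (rule nn_integral_ACG) measurable
  also have "\<dots> = (\<integral>\<^sup>+x. \<integral>\<^sup>+t. H (lincomb d (sqrt (t / (?q x / 2))) x 0 x) \<partial>G \<partial>\<gamma>)"
  proof -
    have "(\<integral>\<^sup>+\<omega>. F (?\<Pi> x) (proposal (?\<Pi> x) \<omega>) \<partial>(G \<Otimes>\<^sub>M \<gamma>)) = (\<integral>\<^sup>+t. H (lincomb d (sqrt (t / (?q x / 2))) x 0 x) \<partial>G)"
      if x [measurable]: "x \<in> space E" and q: "?q x > 0" for x
    proof -
      have [measurable]: "?\<Pi> x \<in> space S" using radial_projection_in_usphere[OF p] by simp
      have "(\<integral>\<^sup>+\<omega>. F (?\<Pi> x) (proposal (?\<Pi> x) \<omega>) \<partial>(G \<Otimes>\<^sub>M \<gamma>)) = (\<integral>\<^sup>+t. \<integral>\<^sup>+w. F (?\<Pi> x) (proposal (?\<Pi> x) (t, w)) \<partial>\<gamma> \<partial>G)"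
        by (rule nn_integral_fst[symmetric]) measurable
      also have "\<dots> = (\<integral>\<^sup>+t. H (lincomb d (sqrt (t / (?q x / 2))) x 0 x) \<partial>G)"
      proof -
        have "(\<integral>\<^sup>+w. F (?\<Pi> x) (proposal (?\<Pi> x) (t, w)) \<partial>\<gamma>) = H (lincomb d (sqrt (t / (?q x / 2))) x 0 x)"
          if "t > 0" for t
          unfolding H_def proposal_radial_projection[OF q that] ..
        then show ?thesis
          using AE_gamma_distribution_pos[of "d / 2" 1]
          by (intro nn_integral_cong_AE) (auto elim: eventually_mono)
      qed
      finally show ?thesis .
    qed
    then show ?thesis
      using AE_gaussian_inv_quadratic_form_pos[OF d] AE_space[of \<gamma>]
      by (intro nn_integral_cong_AE) (auto elim: eventually_elim2)
  qed
  also have "\<dots> = (\<integral>\<^sup>+x. H x \<partial>\<gamma>)"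
    by (rule gaussian_radial_resampling[OF d]) measurable
  also have "\<dots> = pcn (sqrt (1 - s\<^sup>2)) (\<lambda>x y. F (?\<Pi> x) (?\<Pi> y))"
    unfolding pcn_def H_def a_bounds ..
  finally show ?thesis .
qed

text \<open>The dependence of the Gamma rate on the state moves from the measure into the map. Only
  the sigma-algebra of the target of \<open>distr\<close> matters, so \<mu>0 can stand for
  \<open>usphere_borel d\<close>, as \<open>metropolis_hastings_opnorm\<close> expects.\<close>

lemma kernel_eq_distr:
  assumes x: "x \<in> usphere d" and [measurable]: "\<Psi> \<in> borel_measurable S"
  shows "reprojected_pCN_MH lam d p \<Psi> s x = distr (G \<Otimes>\<^sub>M (\<gamma> \<Otimes>\<^sub>M U)) \<mu>0 (mh_step \<Psi> x)"
proof -
  define \<beta> where "\<beta> = inv_quadratic_form lam d x / 2"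
  have \<beta>: "\<beta> > 0" using usphere_inv_quadratic_form_pos[OF x] by (simp add: \<beta>_def)
  interpret G: prob_space G by (rule prob_space_G)
  interpret U: prob_space U by (rule prob_space_U)
  interpret \<gamma>U: pair_prob_space \<gamma> U ..
  have xE [measurable]: "x \<in> space E" "x \<in> space S" using x by (auto simp: usphere_def)
  let ?f = "\<lambda>(t, w, u). let y = pcn_proposal d p s (sqrt t) w x in if u \<le> min 1 (exp (\<Psi> x - \<Psi> y)) then y else x"
  have f: "?f \<in> borel \<Otimes>\<^sub>M (\<gamma> \<Otimes>\<^sub>M U) \<rightarrow>\<^sub>M S"
    unfolding Let_def case_prod_unfold using measurable_pcn_proposal[OF p, measurable (raw)] by measurable
  have "gamma_distribution (d / 2) \<beta> \<Otimes>\<^sub>M (\<gamma> \<Otimes>\<^sub>M U) =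
    distr G borel (\<lambda>t. t / \<beta>) \<Otimes>\<^sub>M distr (\<gamma> \<Otimes>\<^sub>M U) (\<gamma> \<Otimes>\<^sub>M U) (\<lambda>z. z)"
    using d \<beta> by (subst gamma_distribution_scale) (auto simp: distr_id2)
  also have "\<dots> = distr (G \<Otimes>\<^sub>M (\<gamma> \<Otimes>\<^sub>M U)) (borel \<Otimes>\<^sub>M (\<gamma> \<Otimes>\<^sub>M U)) (\<lambda>(t, z). (t / \<beta>, z))"
    by (rule pair_measure_distr) (auto simp: distr_id2 intro: \<gamma>U.sigma_finite_measure_axioms)
  finally have "reprojected_pCN_MH lam d p \<Psi> s x =
    distr (distr (G \<Otimes>\<^sub>M (\<gamma> \<Otimes>\<^sub>M U)) (borel \<Otimes>\<^sub>M (\<gamma> \<Otimes>\<^sub>M U)) (\<lambda>(t, z). (t / \<beta>, z))) S ?f"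
    unfolding reprojected_pCN_MH_def \<beta>_def by simp
  also have "\<dots> = distr (G \<Otimes>\<^sub>M (\<gamma> \<Otimes>\<^sub>M U)) S (?f \<circ> (\<lambda>(t, z). (t / \<beta>, z)))"
    by (rule distr_distr[OF f]) measurable
  also have "\<dots> = distr (G \<Otimes>\<^sub>M (\<gamma> \<Otimes>\<^sub>M U)) \<mu>0 (mh_step \<Psi> x)"
    by (intro distr_cong) (auto simp: mh_step_def proposal_def \<beta>_def Let_def)
  finally show ?thesis .
qed

lemma measurable_mh_step:
  assumes [measurable]: "\<Psi> \<in> borel_measurable S"
  shows "case_prod (mh_step \<Psi>) \<in> S \<Otimes>\<^sub>M (G \<Otimes>\<^sub>M (\<gamma> \<Otimes>\<^sub>M U)) \<rightarrow>\<^sub>M S"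
proof -
  have [measurable]: "(\<lambda>z. proposal (fst z) (fst (snd z), fst (snd (snd z)))) \<in> S \<Otimes>\<^sub>M (G \<Otimes>\<^sub>M (\<gamma> \<Otimes>\<^sub>M U)) \<rightarrow>\<^sub>M S"
    using measurable_proposal by measurable
  show ?thesis
    unfolding mh_step_def case_prod_unfold by measurable
qed

text \<open>Integrating over the uniform variable first leaves a mixture of moving and staying,
  driven by the noise of the proposal alone.\<close>

lemma nn_integral_mh_step:
  assumes x: "x \<in> usphere d" and [measurable]: "\<Psi> \<in> borel_measurable S" "F \<in> borel_measurable S"
  defines "\<alpha> \<equiv> \<lambda>y. min 1 (exp (\<Psi> x - \<Psi> y))"
  shows "(\<integral>\<^sup>+\<omega>. F (mh_step \<Psi> x \<omega>) \<partial>(G \<Otimes>\<^sub>M (\<gamma> \<Otimes>\<^sub>M U))) =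
    (\<integral>\<^sup>+\<omega>. ennreal (\<alpha> (proposal x \<omega>)) * F (proposal x \<omega>) + ennreal (1 - \<alpha> (proposal x \<omega>)) * F x \<partial>(G \<Otimes>\<^sub>M \<gamma>))"
proof -
  interpret G: prob_space G by (rule prob_space_G)
  interpret U: prob_space U by (rule prob_space_U)
  interpret \<gamma>U: pair_prob_space \<gamma> U ..
  have [measurable]: "x \<in> space S" using x by simp
  have [measurable]: "mh_step \<Psi> x \<in> G \<Otimes>\<^sub>M (\<gamma> \<Otimes>\<^sub>M U) \<rightarrow>\<^sub>M S"
    using measurable_Pair2[OF measurable_mh_step[of \<Psi>], of x] x by simp
  have "(\<integral>\<^sup>+\<omega>. F (mh_step \<Psi> x \<omega>) \<partial>(G \<Otimes>\<^sub>M (\<gamma> \<Otimes>\<^sub>M U))) = (\<integral>\<^sup>+t. \<integral>\<^sup>+z. F (mh_step \<Psi> x (t, z)) \<partial>(\<gamma> \<Otimes>\<^sub>M U) \<partial>G)"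
    by (rule \<gamma>U.nn_integral_fst[symmetric]) measurable
  also have "\<dots> = (\<integral>\<^sup>+t. \<integral>\<^sup>+w. \<integral>\<^sup>+u. F (mh_step \<Psi> x (t, w, u)) \<partial>U \<partial>\<gamma> \<partial>G)"
    by (intro nn_integral_cong U.nn_integral_fst[symmetric]) measurable
  also have "\<dots> = (\<integral>\<^sup>+t. \<integral>\<^sup>+w. ennreal (\<alpha> (proposal x (t, w))) * F (proposal x (t, w)) + ennreal (1 - \<alpha> (proposal x (t, w))) * F x \<partial>\<gamma> \<partial>G)"
    unfolding mh_step_def \<alpha>_def prod.case
    by (intro nn_integral_cong nn_integral_uniform_threshold[where F=F]) simp_all
  also have "\<dots> = (\<integral>\<^sup>+\<omega>. ennreal (\<alpha> (proposal x \<omega>)) * F (proposal x \<omega>) + ennreal (1 - \<alpha> (proposal x \<omega>)) * F x \<partial>(G \<Otimes>\<^sub>M \<gamma>))"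
    unfolding \<alpha>_def by (rule nn_integral_fst) measurable
  finally show ?thesis .
qed

text \<open>A function on the sphere composed with the radial projection is a function on the whole
  space, so the Gaussian estimates apply to it and carry over with the same constants. The resulting
  bound contains neither \<open>d\<close> nor \<open>lam\<close> nor \<open>p\<close>.\<close>

lemma reprojected_pcn_opnorm:
  assumes \<Psi> [measurable]: "\<Psi> \<in> borel_measurable S" and B: "\<And>x. x \<in> usphere d \<Longrightarrow> \<bar>\<Psi> x\<bar> \<le> B"
    and m: "((sqrt (1 - s\<^sup>2)) ^ (2 ^ m))\<^sup>2 < 1/2"
  shows "L2_0_opnorm (gibbs_measure \<mu>0 \<Psi>) (reprojected_pCN_MH lam d p \<Psi> s) \<le>
    ereal (1 - min (exp (- 6 * B) / 4 ^ Suc m) (2 / 9 * exp (- 4 * B)))"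
proof (rule metropolis_hastings_opnorm[where P="G \<Otimes>\<^sub>M \<gamma>" and P'="G \<Otimes>\<^sub>M (\<gamma> \<Otimes>\<^sub>M U)" and \<psi>=proposal and N="mh_step \<Psi>"])
  interpret G: prob_space G by (rule prob_space_G)
  interpret U: prob_space U by (rule prob_space_U)
  interpret G\<gamma>: pair_prob_space G \<gamma> ..
  interpret \<gamma>U: pair_prob_space \<gamma> U ..
  interpret G\<gamma>U: pair_prob_space G "\<gamma> \<Otimes>\<^sub>M U" ..
  show "prob_space \<mu>0" by (rule prob_space_ACG)
  show "prob_space (G \<Otimes>\<^sub>M \<gamma>)" by (rule G\<gamma>.P.prob_space_axioms)
  show "prob_space (G \<Otimes>\<^sub>M (\<gamma> \<Otimes>\<^sub>M U))" by (rule G\<gamma>U.P.prob_space_axioms)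
  show "case_prod proposal \<in> \<mu>0 \<Otimes>\<^sub>M (G \<Otimes>\<^sub>M \<gamma>) \<rightarrow>\<^sub>M \<mu>0" by measurable
  show "case_prod (mh_step \<Psi>) \<in> \<mu>0 \<Otimes>\<^sub>M (G \<Otimes>\<^sub>M (\<gamma> \<Otimes>\<^sub>M U)) \<rightarrow>\<^sub>M \<mu>0"
    using measurable_mh_step[OF \<Psi>] by measurable
  show "reprojected_pCN_MH lam d p \<Psi> s x = distr (G \<Otimes>\<^sub>M (\<gamma> \<Otimes>\<^sub>M U)) \<mu>0 (mh_step \<Psi> x)" if "x \<in> space \<mu>0" for x
    using that by (simp add: kernel_eq_distr)
  show "(\<integral>\<^sup>+\<omega>. F (mh_step \<Psi> x \<omega>) \<partial>(G \<Otimes>\<^sub>M (\<gamma> \<Otimes>\<^sub>M U))) =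
    (\<integral>\<^sup>+\<omega>. ennreal (min 1 (exp (\<Psi> x - \<Psi> (proposal x \<omega>)))) * F (proposal x \<omega>) +
      ennreal (1 - min 1 (exp (\<Psi> x - \<Psi> (proposal x \<omega>)))) * F x \<partial>(G \<Otimes>\<^sub>M \<gamma>))"
    if "x \<in> space \<mu>0" "F \<in> borel_measurable \<mu>0" for x F
    using that by (intro nn_integral_mh_step) (auto cong: measurable_cong_sets)
  show "(0::real) < 4 ^ Suc m" by simp
  show "\<Psi> \<in> borel_measurable \<mu>0" by measurable
  show "\<bar>\<Psi> x\<bar> \<le> B" if "x \<in> space \<mu>0" for x using that B by simp
next
  fix F :: "(nat \<Rightarrow> real) \<Rightarrow> (nat \<Rightarrow> real) \<Rightarrow> ennreal"
  assume "case_prod F \<in> borel_measurable (\<mu>0 \<Otimes>\<^sub>M \<mu>0)"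
  then have [measurable]: "case_prod F \<in> borel_measurable (S \<Otimes>\<^sub>M S)"
    by (simp cong: sets_pair_measure_cong measurable_cong_sets)
  have "pcn (sqrt (1 - s\<^sup>2)) (\<lambda>x y. F (radial_projection d p y) (radial_projection d p x)) =
    pcn (sqrt (1 - s\<^sup>2)) (\<lambda>x y. F (radial_projection d p x) (radial_projection d p y))"
    by (rule pcn_swap[OF a_bounds(1,2)]) measurable
  moreover have "case_prod (\<lambda>x y. F y x) \<in> borel_measurable (S \<Otimes>\<^sub>M S)" by measurable
  ultimately show "(\<integral>\<^sup>+x. \<integral>\<^sup>+\<omega>. F x (proposal x \<omega>) \<partial>(G \<Otimes>\<^sub>M \<gamma>) \<partial>\<mu>0) = (\<integral>\<^sup>+x. \<integral>\<^sup>+\<omega>. F (proposal x \<omega>) x \<partial>(G \<Otimes>\<^sub>M \<gamma>) \<partial>\<mu>0)"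
    using nn_integral_proposal[of F] nn_integral_proposal[of "\<lambda>x y. F y x"] by simp
next
  fix f :: "(nat \<Rightarrow> real) \<Rightarrow> real" assume "f \<in> borel_measurable \<mu>0"
  then have [measurable]: "f \<in> borel_measurable S" by (simp cong: measurable_cong_sets)
  interpret \<mu>0: prob_space \<mu>0 by (rule prob_space_ACG)
  let ?f = "\<lambda>x. f (radial_projection d p x)"
  have "(\<integral>\<^sup>+x. \<integral>\<^sup>+y. ennreal ((f x - f y)\<^sup>2) \<partial>\<mu>0 \<partial>\<mu>0) = (\<integral>\<^sup>+x. \<integral>\<^sup>+y. ennreal ((?f x - f y)\<^sup>2) \<partial>\<mu>0 \<partial>\<gamma>)"
    by (rule nn_integral_ACG) measurable
  also have "\<dots> = (\<integral>\<^sup>+x. \<integral>\<^sup>+y. ennreal ((?f x - ?f y)\<^sup>2) \<partial>\<gamma> \<partial>\<gamma>)"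
    by (intro nn_integral_cong nn_integral_ACG) measurable
  also have "\<dots> \<le> 4 ^ Suc m * dirichlet (sqrt (1 - s\<^sup>2)) ?f"
    using m by (intro variance_le_dirichlet a_bounds) auto
  also have "dirichlet (sqrt (1 - s\<^sup>2)) ?f = (\<integral>\<^sup>+x. \<integral>\<^sup>+\<omega>. ennreal ((f x - f (proposal x \<omega>))\<^sup>2) \<partial>(G \<Otimes>\<^sub>M \<gamma>) \<partial>\<mu>0)"
    by (rule nn_integral_proposal[symmetric]) measurable
  also have "(4 ^ Suc m :: ennreal) = ennreal (4 ^ Suc m)"
    by (simp add: ennreal_power[symmetric] ennreal_mult)
  finally show "(\<integral>\<^sup>+x. \<integral>\<^sup>+y. ennreal ((f x - f y)\<^sup>2) \<partial>\<mu>0 \<partial>\<mu>0) \<le>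
    ennreal (4 ^ Suc m) * (\<integral>\<^sup>+x. \<integral>\<^sup>+\<omega>. ennreal ((f x - f (proposal x \<omega>))\<^sup>2) \<partial>(G \<Otimes>\<^sub>M \<gamma>) \<partial>\<mu>0)" .
  have "4 * (\<integral>\<^sup>+x. ennreal ((f x)\<^sup>2) \<partial>\<mu>0) = 4 * (\<integral>\<^sup>+x. ennreal ((?f x)\<^sup>2) \<partial>\<gamma>)"
    by (subst nn_integral_ACG) auto
  also have "\<dots> \<le> 9 * pcn (sqrt (1 - s\<^sup>2)) (\<lambda>x y. ennreal ((?f x + ?f y)\<^sup>2))"
    by (intro pcn_sq_sum_lower a_bounds) measurable
  also have "pcn (sqrt (1 - s\<^sup>2)) (\<lambda>x y. ennreal ((?f x + ?f y)\<^sup>2)) = (\<integral>\<^sup>+x. \<integral>\<^sup>+\<omega>. ennreal ((f x + f (proposal x \<omega>))\<^sup>2) \<partial>(G \<Otimes>\<^sub>M \<gamma>) \<partial>\<mu>0)"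
    by (rule nn_integral_proposal[symmetric]) measurable
  finally show "4 * (\<integral>\<^sup>+x. ennreal ((f x)\<^sup>2) \<partial>\<mu>0) \<le>
    9 * (\<integral>\<^sup>+x. \<integral>\<^sup>+\<omega>. ennreal ((f x + f (proposal x \<omega>))\<^sup>2) \<partial>(G \<Otimes>\<^sub>M \<gamma>) \<partial>\<mu>0)" .
qed

end


section \<open>Embedding into the Hilbert space and the choice of uniform constants\<close>

lemma embed_coords_in_sphere:
  assumes orth: "\<And>i j. e i \<bullet> e j = (if i = j then 1 else 0)" and x: "x \<in> usphere d"
  shows "embed_coords e d x \<in> sphere 0 1"
proof -
  have "(norm (embed_coords e d x))\<^sup>2 = (\<Sum>j<d. (x j)\<^sup>2)"
    unfolding power2_norm_eq_inner embed_coords_def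
    by (simp add: inner_sum_left inner_sum_right orth sum.delta power2_eq_square
        if_distrib[of "\<lambda>c. _ * c"] cong: if_cong)
  also have "\<dots> = (L2_set x {..<d})\<^sup>2"
    unfolding L2_set_def by (simp add: sum_nonneg)
  also have "\<dots> = 1" using x by (simp add: usphere_def)
  finally show ?thesis
    using norm_ge_zero[of "embed_coords e d x"] by (simp add: power2_eq_1_iff)
qed

lemma measurable_embed_coords:
  fixes e :: "nat \<Rightarrow> 'a::{real_inner, second_countable_topology}"
  assumes "\<And>i j. e i \<bullet> e j = (if i = j then 1 else 0)"
  shows "embed_coords e d \<in> usphere_borel d \<rightarrow>\<^sub>M restrict_space borel (sphere 0 1)"
proof (rule measurable_restrict_space2)
  have "(\<lambda>x. x) \<in> usphere_borel d \<rightarrow>\<^sub>M euclidean_borel d"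
    by (rule measurable_usphere_borelD) simp
  then show "embed_coords e d \<in> borel_measurable (usphere_borel d)"
    unfolding embed_coords_def
    by (intro borel_measurable_sum borel_measurable_scaleR measurable_coord) auto
qed (use embed_coords_in_sphere[OF assms] in auto)

lemma power_two_power_small:
  fixes a :: real
  assumes a: "0 \<le> a" "a < 1"
  shows "\<exists>m. (a ^ (2 ^ m))\<^sup>2 < 1/2"
proof -
  obtain n where n: "a ^ n < 1/2" using real_arch_pow_inv[of "1/2" a] a by auto
  \<comment> \<open>The n with a^n < 1/2 serves as m itself, because the exponent 2 * 2^n is at
    least n.\<close>
  have "n \<le> 2 ^ n * 2" using less_exp[of n] by linarith
  then have "a ^ (2 ^ n * 2) \<le> a ^ n" using a by (intro power_decreasing) auto
  then show ?thesis using n by (intro exI[of _ n]) (simp add: power_mult)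
qed

theorem theorem3p10:
  fixes C :: "'a::{real_inner, polish_space} \<Rightarrow> 'a"
    and e :: "nat \<Rightarrow> 'a"
    and lam :: "nat \<Rightarrow> real"
    and \<Phi> :: "'a \<Rightarrow> real"
    and p :: "nat \<Rightarrow> nat \<Rightarrow> real"
    and s :: real
  assumes infinite_dim: "\<not> (\<exists>B::'a set. finite B \<and> span B = UNIV)"
    and cov: "covariance_operator C" "nondegenerate C" "psd_trace_class C"
    and eigenbasis: "complete_orthonormal_system e" "\<And>j. C (e j) = lam j *\<^sub>R e j"
    and lam_pos: "\<And>j. lam j > 0"
    and \<Phi>_measurable: "\<Phi> \<in> borel_measurable (restrict_space borel (sphere 0 1))"
    and \<Phi>_bounded: "\<exists>B. \<forall>x\<in>sphere 0 1. \<bar>\<Phi> x\<bar> \<le> B"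
    and p: "\<And>d. d \<ge> 1 \<Longrightarrow> p d \<in> usphere d"
    and s: "0 < s" "s \<le> 1"
  shows "\<exists>\<beta>>0. ereal \<beta> \<le> (INF d\<in>{1..}.
    spectral_gap (gibbs_measure (ACG lam d (p d)) (\<lambda>x. \<Phi> (embed_coords e d x)))
      (reprojected_pCN_MH lam d (p d) (\<lambda>x. \<Phi> (embed_coords e d x)) s))"
proof -
  have orth: "e i \<bullet> e j = (if i = j then 1 else 0)" for i j
    using eigenbasis(1) by (simp add: complete_orthonormal_system_def)
  \<comment> \<open>One bound on the sphere of the Hilbert space serves every \<open>d\<close>,
    since each finite-dimensional sphere embeds into it.\<close>
  obtain B where B: "\<And>x. x \<in> sphere 0 1 \<Longrightarrow> \<bar>\<Phi> x\<bar> \<le> B" using \<Phi>_bounded by blast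
  have "0 < s\<^sup>2" "s\<^sup>2 \<le> 1" using s by (auto simp: power_le_one)
  then have "0 \<le> sqrt (1 - s\<^sup>2)" "sqrt (1 - s\<^sup>2) < 1" by auto
  \<comment> \<open>Here m is chosen before \<open>d\<close> and depends only on s.\<close>
  from power_two_power_small[OF this] obtain m where m: "((sqrt (1 - s\<^sup>2)) ^ (2 ^ m))\<^sup>2 < 1/2" by blast
  define \<beta> where "\<beta> = min (exp (- 6 * B) / 4 ^ Suc m) (2 / 9 * exp (- 4 * B))"
  have "ereal \<beta> \<le> spectral_gap (gibbs_measure (ACG lam d (p d)) (\<lambda>x. \<Phi> (embed_coords e d x)))
      (reprojected_pCN_MH lam d (p d) (\<lambda>x. \<Phi> (embed_coords e d x)) s)" if d: "d \<ge> 1" for d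
  proof -
    interpret reprojected_pcn lam d "p d" s
      using lam_pos p s d by unfold_locales auto
    have "(\<lambda>x. \<Phi> (embed_coords e d x)) \<in> borel_measurable (usphere_borel d)"
      by (rule measurable_compose[OF measurable_embed_coords[OF orth] \<Phi>_measurable])
    moreover have "\<bar>\<Phi> (embed_coords e d x)\<bar> \<le> B" if "x \<in> usphere d" for x
      by (rule B[OF embed_coords_in_sphere[OF orth that]])
    ultimately have "L2_0_opnorm (gibbs_measure (ACG lam d (p d)) (\<lambda>x. \<Phi> (embed_coords e d x)))
      (reprojected_pCN_MH lam d (p d) (\<lambda>x. \<Phi> (embed_coords e d x)) s) \<le> ereal (1 - \<beta>)"
      unfolding \<beta>_def by (rule reprojected_pcn_opnorm[OF _ _ m])
    then have "1 - ereal (1 - \<beta>) \<le> spectral_gap (gibbs_measure (ACG lam d (p d)) (\<lambda>x. \<Phi> (embed_coords e d x)))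
      (reprojected_pCN_MH lam d (p d) (\<lambda>x. \<Phi> (embed_coords e d x)) s)"
      unfolding spectral_gap_def by (intro ereal_minus_mono) auto
    then show ?thesis by (simp add: one_ereal_def)
  qed
  moreover have "\<beta> > 0" by (simp add: \<beta>_def)
  ultimately show ?thesis by (intro exI[of _ \<beta>]) (auto intro!: INF_greatest)
qed

end
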